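(* Let $k\ge2$ and let $(\mathfrak g,\nu)$ be a semisimple $k$-symmetric pair with canonical decomposition $\mathfrak g=\mathfrak h\oplus\mathfrak m$. Then $(\mathfrak g,\nu)$ is symplectic if and only if there is an element $Z\in Z(\mathfrak h)$ (the center of $\mathfrak h$) such that $\ker(\operatorname{ad}_Z|_{\mathfrak m})=\{0\}$.
   Context: A $k$-symmetric pair $(\mathfrak g,\nu)$ consists of a finite-dimensional real Lie algebra $\mathfrak g$ and an automorphism $\nu$ of $\mathfrak g$ with $\nu^k=\mathrm{id}$, where $k\ge2$ is the least integer with this property. Put $A=\mathrm{id}-\nu$, $\mathfrak h=\ker A$, $\mathfrak m=\operatorname{Im}A$; then $\mathfrak g=\mathfrak h\oplus\mathfrak m$ is called the canonical decomposition, and $[\mathfrak h,\mathfrak h]\subseteq\mathfrak h$, $[\mathfrak h,\mathfrak m]\subseteq\mathfrak m$. The pair is semisimple if $\mathfrak g$ is semisimple. The pair $(\mathfrak g,\nu)$ is symplectic if there is an $\operatorname{ad}_{\mathfrak h}$-invariant symplectic form $\Omega$ on $\mathfrak m$ preserved by $\nu|_{\mathfrak m}$, i.e. a nondegenerate skew-symmetric bilinear form on $\mathfrak m$, invariant under $\operatorname{ad}_{\mathfrak h}$ and $\nu|_{\mathfrak m}$, whose extension $\underline\Omega$ to $\mathfrak g$ by $i(X)\underline\Omega=0$ for $X\in\mathfrak h$ is a Chevalley–Eilenberg 2-cocycle of $\mathfrak g$ with trivial real coefficients. *)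

theory Defs
  imports "HOL-Analysis.Analysis"
begin

text \<open>
  The underlying vector space of a Lie algebra is a whole type of class \<open>real_vector\<close>; no inner
  product or topology on it is assumed.  Subalgebras and ideals are sets.
\<close>

locale lie_algebra =
  fixes br :: "'a::real_vector \<Rightarrow> 'a \<Rightarrow> 'a"
  assumes bilinear_br: "bilinear br"
    and br_self: "br X X = 0"
    and jacobi: "br X (br Y Z) + br Y (br Z X) + br Z (br X Y) = 0"

locale fin_dim_lie_algebra = lie_algebra br
  for br :: "'a::real_vector \<Rightarrow> 'a \<Rightarrow> 'a" +
  assumes fin_dim: "\<exists>B :: 'a set. finite B \<and> span B = UNIV"

definition lie_automorphism :: "('a::real_vector \<Rightarrow> 'a \<Rightarrow> 'a) \<Rightarrow> ('a \<Rightarrow> 'a) \<Rightarrow> bool" where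
  "lie_automorphism br \<nu> \<longleftrightarrow> linear \<nu> \<and> bij \<nu> \<and> (\<forall>X Y. \<nu> (br X Y) = br (\<nu> X) (\<nu> Y))"

definition lie_ideal :: "('a::real_vector \<Rightarrow> 'a \<Rightarrow> 'a) \<Rightarrow> 'a set \<Rightarrow> bool" where
  "lie_ideal br I \<longleftrightarrow> subspace I \<and> (\<forall>X. \<forall>Y\<in>I. br X Y \<in> I)"

primrec derived_series :: "('a::real_vector \<Rightarrow> 'a \<Rightarrow> 'a) \<Rightarrow> 'a set \<Rightarrow> nat \<Rightarrow> 'a set" where
  "derived_series br S 0 = S"
| "derived_series br S (Suc n) =
     span {br X Y | X Y. X \<in> derived_series br S n \<and> Y \<in> derived_series br S n}"

definition lie_solvable :: "('a::real_vector \<Rightarrow> 'a \<Rightarrow> 'a) \<Rightarrow> 'a set \<Rightarrow> bool" where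
  "lie_solvable br S \<longleftrightarrow> (\<exists>n. derived_series br S n = {0})"

text \<open>Vanishing of the radical, the largest solvable ideal.\<close>

definition lie_semisimple :: "('a::real_vector \<Rightarrow> 'a \<Rightarrow> 'a) \<Rightarrow> bool" where
  "lie_semisimple br \<longleftrightarrow> (\<forall>I. lie_ideal br I \<and> lie_solvable br I \<longrightarrow> I = {0})"

definition lie_center :: "('a::real_vector \<Rightarrow> 'a \<Rightarrow> 'a) \<Rightarrow> 'a set \<Rightarrow> 'a set" where
  "lie_center br S = {Z \<in> S. \<forall>X\<in>S. br Z X = 0}"

text \<open>
  The exponent \<open>k\<close> is the order of \<open>\<nu>\<close>, i.e. the least positive exponent with
  \<open>\<nu> ^^ k = id\<close>, and it is at least 2; in particular \<open>\<nu> \<noteq> id\<close>.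
\<close>

definition k_symmetric_pair ::
    "('a::real_vector \<Rightarrow> 'a \<Rightarrow> 'a) \<Rightarrow> ('a \<Rightarrow> 'a) \<Rightarrow> nat \<Rightarrow> bool" where
  "k_symmetric_pair br \<nu> k \<longleftrightarrow>
     fin_dim_lie_algebra br \<and> lie_automorphism br \<nu> \<and>
     2 \<le> k \<and> \<nu> ^^ k = id \<and> (\<forall>j. 0 < j \<and> j < k \<longrightarrow> \<nu> ^^ j \<noteq> id)"

definition canon_h :: "('a::real_vector \<Rightarrow> 'a) \<Rightarrow> 'a set" where
  "canon_h \<nu> = {X. X - \<nu> X = 0}"

definition canon_m :: "('a::real_vector \<Rightarrow> 'a) \<Rightarrow> 'a set" where
  "canon_m \<nu> = range (\<lambda>X. X - \<nu> X)"

text \<open>Projection onto \<open>canon_m \<nu>\<close> along \<open>canon_h \<nu>\<close>; meaningful by \<open>canon_decomp\<close> below.\<close>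

definition proj_m :: "('a::real_vector \<Rightarrow> 'a) \<Rightarrow> 'a \<Rightarrow> 'a" where
  "proj_m \<nu> X = (THE M. M \<in> canon_m \<nu> \<and> X - M \<in> canon_h \<nu>)"

lemma canon_decomp:
  assumes "k_symmetric_pair br \<nu> k"
  shows "\<exists>!M. M \<in> canon_m \<nu> \<and> X - M \<in> canon_h \<nu>"
proof -
  have lin: "linear \<nu>" and k: "k > 0" and per: "\<nu> ^^ k = id"
    using assms by (auto simp: k_symmetric_pair_def lie_automorphism_def)
  interpret linear \<nu> by (rule lin)
  have sub: "subspace (canon_m \<nu>)"
  proof -
    have "linear (\<lambda>X. X - \<nu> X)"
      by (intro linearI) (simp_all add: add scale scaleR_diff_right)
    then show ?thesis
      unfolding canon_m_def using linear_subspace_image subspace_UNIV by blast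
  qed
  have diff_pow: "Y - (\<nu> ^^ j) Y \<in> canon_m \<nu>" for Y j
  proof (induction j)
    case 0
    show ?case using subspace_0[OF sub] by simp
  next
    case (Suc j)
    have "(\<nu> ^^ j) Y - \<nu> ((\<nu> ^^ j) Y) \<in> canon_m \<nu>"
      by (auto simp: canon_m_def)
    from subspace_add[OF sub Suc.IH this] show ?case by simp
  qed
  define avg where "avg = (1 / real k) *\<^sub>R (\<Sum>j<k. (\<nu> ^^ j) X)"
  have "\<nu> (\<Sum>j<k. (\<nu> ^^ j) X) = (\<Sum>j<k. (\<nu> ^^ Suc j) X)"
    by (simp add: sum)
  moreover have "(\<Sum>j<k. (\<nu> ^^ j) X - (\<nu> ^^ Suc j) X) = (\<nu> ^^ 0) X - (\<nu> ^^ k) X"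
    by (rule sum_lessThan_telescope')
  ultimately have "\<nu> avg = avg"
    using per by (simp add: avg_def scale sum_subtractf)
  then have avg_h: "avg \<in> canon_h \<nu>" by (simp add: canon_h_def)
  have "(1 / real k) *\<^sub>R (\<Sum>j<k. X - (\<nu> ^^ j) X) \<in> canon_m \<nu>"
    by (intro subspace_scale[OF sub] subspace_sum[OF sub] diff_pow)
  moreover have "(1 / real k) *\<^sub>R (\<Sum>j<k. X - (\<nu> ^^ j) X) = X - avg"
    using k by (simp add: avg_def sum_subtractf scaleR_diff_right sum_constant_scaleR)
  ultimately have avg_m: "X - avg \<in> canon_m \<nu>" by simp
  have zero: "W = 0" if W: "W \<in> canon_m \<nu>" "W \<in> canon_h \<nu>" for W
  proof -
    obtain Y where Y: "W = Y - \<nu> Y" using W(1) unfolding canon_m_def by blast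
    have "\<nu> W = W" using W by (simp add: canon_h_def)
    then have pow: "(\<nu> ^^ j) W = W" for j by (induction j) simp_all
    have lin_pow: "linear (\<nu> ^^ j)" for j
    proof (induction j)
      case 0
      show ?case by (simp add: linear_iff)
    next
      case (Suc j)
      show ?case using linear_compose[OF Suc.IH lin] by (simp add: comp_def)
    qed
    have "W = (\<nu> ^^ j) Y - (\<nu> ^^ Suc j) Y" for j
    proof -
      have "W = (\<nu> ^^ j) (Y - \<nu> Y)" using pow Y by simp
      also have "\<dots> = (\<nu> ^^ j) Y - (\<nu> ^^ j) (\<nu> Y)" by (rule linear_diff[OF lin_pow])
      finally show ?thesis by (simp only: funpow_Suc_right o_apply)
    qed
    then have "(\<Sum>j<k. W) = (\<Sum>j<k. (\<nu> ^^ j) Y - (\<nu> ^^ Suc j) Y)"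
      by (intro sum.cong) auto
    also have "\<dots> = (\<nu> ^^ 0) Y - (\<nu> ^^ k) Y" by (rule sum_lessThan_telescope')
    also have "\<dots> = 0" using per by simp
    finally show "W = 0" using k by (simp add: sum_constant_scaleR)
  qed
  show ?thesis
  proof (rule ex1I)
    show "X - avg \<in> canon_m \<nu> \<and> X - (X - avg) \<in> canon_h \<nu>"
      using avg_m avg_h by simp
  next
    fix M assume M: "M \<in> canon_m \<nu> \<and> X - M \<in> canon_h \<nu>"
    have "X - avg - M \<in> canon_m \<nu>" using subspace_diff[OF sub avg_m] M by blast
    moreover have "X - avg - M \<in> canon_h \<nu>"
      using M avg_h by (simp add: canon_h_def diff add algebra_simps)
    ultimately have "X - avg - M = 0" by (rule zero)
    then show "M = X - avg" by simp
  qed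
qed

text \<open>
  Forms on a subspace \<open>M\<close> are total functions constrained only on \<open>M\<close>; their values elsewhere
  are irrelevant.
\<close>

definition bilinear_form_on :: "'a::real_vector set \<Rightarrow> ('a \<Rightarrow> 'a \<Rightarrow> real) \<Rightarrow> bool" where
  "bilinear_form_on M \<Omega> \<longleftrightarrow>
     (\<forall>X\<in>M. \<forall>Y\<in>M. \<forall>Z\<in>M. \<Omega> (X + Y) Z = \<Omega> X Z + \<Omega> Y Z \<and> \<Omega> Z (X + Y) = \<Omega> Z X + \<Omega> Z Y) \<and>
     (\<forall>c. \<forall>X\<in>M. \<forall>Y\<in>M. \<Omega> (c *\<^sub>R X) Y = c * \<Omega> X Y \<and> \<Omega> X (c *\<^sub>R Y) = c * \<Omega> X Y)"

definition skew_on :: "'a set \<Rightarrow> ('a \<Rightarrow> 'a \<Rightarrow> real) \<Rightarrow> bool" where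
  "skew_on M \<Omega> \<longleftrightarrow> (\<forall>X\<in>M. \<forall>Y\<in>M. \<Omega> X Y = - \<Omega> Y X)"

definition nondegenerate_on :: "'a::real_vector set \<Rightarrow> ('a \<Rightarrow> 'a \<Rightarrow> real) \<Rightarrow> bool" where
  "nondegenerate_on M \<Omega> \<longleftrightarrow> (\<forall>X\<in>M. (\<forall>Y\<in>M. \<Omega> X Y = 0) \<longrightarrow> X = 0)"

text \<open>Chevalley--Eilenberg differential of a 2-cochain with trivial real coefficients.\<close>

definition ce_d2 ::
    "('a \<Rightarrow> 'a \<Rightarrow> 'a) \<Rightarrow> ('a \<Rightarrow> 'a \<Rightarrow> real) \<Rightarrow> 'a \<Rightarrow> 'a \<Rightarrow> 'a \<Rightarrow> real" where
  "ce_d2 br \<omega> X Y Z = - \<omega> (br X Y) Z + \<omega> (br X Z) Y - \<omega> (br Y Z) X"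

definition ce_2cocycle ::
    "('a::real_vector \<Rightarrow> 'a \<Rightarrow> 'a) \<Rightarrow> ('a \<Rightarrow> 'a \<Rightarrow> real) \<Rightarrow> bool" where
  "ce_2cocycle br \<omega> \<longleftrightarrow> bilinear \<omega> \<and> skew_on UNIV \<omega> \<and> (\<forall>X Y Z. ce_d2 br \<omega> X Y Z = 0)"

definition extend_form ::
    "('a::real_vector \<Rightarrow> 'a) \<Rightarrow> ('a \<Rightarrow> 'a \<Rightarrow> real) \<Rightarrow> 'a \<Rightarrow> 'a \<Rightarrow> real" where
  "extend_form \<nu> \<Omega> X Y = \<Omega> (proj_m \<nu> X) (proj_m \<nu> Y)"

definition symplectic_pair ::
    "('a::real_vector \<Rightarrow> 'a \<Rightarrow> 'a) \<Rightarrow> ('a \<Rightarrow> 'a) \<Rightarrow> bool" where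
  "symplectic_pair br \<nu> \<longleftrightarrow>
     (\<exists>\<Omega>. bilinear_form_on (canon_m \<nu>) \<Omega> \<and> skew_on (canon_m \<nu>) \<Omega> \<and>
          nondegenerate_on (canon_m \<nu>) \<Omega> \<and>
          (\<forall>H\<in>canon_h \<nu>. \<forall>X\<in>canon_m \<nu>. \<forall>Y\<in>canon_m \<nu>. \<Omega> (br H X) Y + \<Omega> X (br H Y) = 0) \<and>
          (\<forall>X\<in>canon_m \<nu>. \<forall>Y\<in>canon_m \<nu>. \<Omega> (\<nu> X) (\<nu> Y) = \<Omega> X Y) \<and>
          ce_2cocycle br (extend_form \<nu> \<Omega>))"

end

theory Submission
  imports Defs "Jordan_Normal_Form.Jordan_Normal_Form_Existence"
begin

text \<open>
  Let \<open>B\<close> be the Killing form of \<open>\<gg>\<close>.  Everything rests on two facts about a semisimple \<open>\<gg>\<close>: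
  \<open>B\<close> is nondegenerate, and consequently every 2-cocycle has the form
  \<open>(X, Y) \<mapsto> B(Z, [X, Y])\<close> for some \<open>Z \<in> \<gg>\<close>.  Given a symplectic form on \<open>\<mm>\<close>, this yields an
  element \<open>Z\<close> representing its extension.  The extension vanishes on \<open>\<hh>\<close>, so \<open>B([Z, H], Y) = 0\<close>
  for all \<open>Y\<close>, that is, \<open>Z\<close> centralizes \<open>\<hh>\<close>; it is invariant under \<open>\<nu>\<close>, so \<open>\<nu> Z = Z\<close>; it is
  nondegenerate on \<open>\<mm>\<close>, so \<open>ad Z\<close> is injective there.  In the other direction the form
  \<open>B(Z, [X, Y])\<close> on \<open>\<mm>\<close> works, because \<open>B(\<hh>, \<mm>) = 0\<close> turns the nondegeneracy of \<open>B\<close> into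
  nondegeneracy of \<open>B([Z, X], Y)\<close> on \<open>\<mm>\<close>.

  Nondegeneracy of \<open>B\<close> is Cartan's criterion (\<open>killing_nondegenerate\<close>).  The radical \<open>K\<close> of \<open>B\<close> is
  an ideal; its derived series ends in an ideal \<open>P = [P, P]\<close>.  For \<open>x \<in> P\<close> and any derivation \<open>Y\<close>
  the trace of \<open>ad x \<circ> Y\<close> vanishes, since for \<open>x = [u, v]\<close> it equals \<open>-B(u, Y v)\<close> with \<open>u \<in> K\<close>.
  If one takes for \<open>Y\<close> the derivation that acts on each generalized eigenspace of \<open>ad x\<close> as the
  complex conjugate of the eigenvalue, this trace is the sum of the \<open>|\<lambda>|\<^sup>2\<close>, so \<open>ad x\<close> is nilpotent.
  By Engel's theorem a nonzero \<open>P\<close> would have a nonzero centre, an abelian ideal of \<open>\<gg>\<close>.  Hence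
  \<open>P = 0\<close>, so \<open>K\<close> is solvable and therefore zero.

  That the conjugated operator is again a derivation is a statement about tensors: \<open>D\<close> is a
  derivation if and only if it annihilates the structure tensor in \<open>\<gg>\<^sup>* \<otimes> \<gg>\<^sup>* \<otimes> \<gg>\<close>.  In a Jordan basis
  such a tensor has only components of weight zero, and complex conjugation of all weights
  preserves this property.  To have complex eigenvalues without building the complexification of
  \<open>\<gg>\<close>, this part is carried out on coordinate arrays; the real part of the resulting complex
  matrix is a derivation of \<open>\<gg>\<close> with the same (real) trace.
\<close>

hide_const (open) VectorSpace.subspace
hide_fact (open) VectorSpace.subspace_def

section \<open>Conjugating the eigenvalues of an operator that annihilates a tensor\<close>

lemma jordan_matrix_entry_nonzero:
  assumes "i < sum_list (map fst n_as)" "j < sum_list (map fst n_as)"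
    and "jordan_matrix n_as $$ (i, j) \<noteq> 0"
  shows "i \<le> j \<and> jordan_matrix n_as $$ (i, i) = jordan_matrix n_as $$ (j, j)"
  using assms
proof (induction n_as arbitrary: i j)
  case Nil
  then show ?case by simp
next
  case (Cons na n_as)
  obtain m a where na: "na = (m, a)" by force
  let ?N = "sum_list (map fst n_as)"
  have lt: "i < m + ?N" "j < m + ?N" using Cons.prems na by auto
  have entry: "jordan_matrix (na # n_as) $$ (i', j') =
      (if i' < m then if j' < m then jordan_block m a $$ (i', j') else 0
       else if j' < m then 0 else jordan_matrix n_as $$ (i' - m, j' - m))"
    if "i' < m + ?N" "j' < m + ?N" for i' j'
    using that unfolding na jordan_matrix_Cons by (subst index_mat_four_block) auto
  from Cons.prems(3) consider "i < m" "j < m" | "\<not> i < m" "\<not> j < m"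
    unfolding entry[OF lt] by (auto split: if_splits)
  then show ?case
  proof cases
    case 1
    then show ?thesis
      using Cons.prems(3) lt by (auto simp: entry split: if_splits)
  next
    case 2
    have "i - m \<le> j - m \<and> jordan_matrix n_as $$ (i - m, i - m) = jordan_matrix n_as $$ (j - m, j - m)"
      using 2 lt Cons.prems(3) by (intro Cons.IH) (auto simp: entry)
    then show ?thesis using 2 lt by (auto simp: entry)
  qed
qed

text \<open>
  The columns of \<open>P\<close> form a Jordan basis for \<open>D\<close> and \<open>Q\<close> is its dual basis.  Of the Jordan form
  \<open>J\<close> only this is retained: it is upper triangular, and a nonzero entry joins two basis vectors
  with the same eigenvalue.
\<close>

lemma jordan_basis_exists:
  fixes D :: "nat \<Rightarrow> nat \<Rightarrow> complex"
  obtains P Q J :: "nat \<Rightarrow> nat \<Rightarrow> complex" where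
    "\<And>i j. i < n \<Longrightarrow> j < n \<Longrightarrow> (\<Sum>a<n. P i a * Q a j) = of_bool (i = j)"
    "\<And>i j. i < n \<Longrightarrow> j < n \<Longrightarrow> (\<Sum>a<n. Q i a * P a j) = of_bool (i = j)"
    "\<And>i j. i < n \<Longrightarrow> j < n \<Longrightarrow> (\<Sum>a<n. D i a * P a j) = (\<Sum>a<n. P i a * J a j)"
    "\<And>i j. i < n \<Longrightarrow> j < n \<Longrightarrow> (\<Sum>a<n. Q i a * D a j) = (\<Sum>a<n. J i a * Q a j)"
    "\<And>i j. i < n \<Longrightarrow> j < n \<Longrightarrow> J i j \<noteq> 0 \<Longrightarrow> i \<le> j \<and> J i i = J j j"
proof -
  define A where "A = Matrix.mat n n (\<lambda>(i, j). D i j)"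
  have A: "A \<in> carrier_mat n n" by (simp add: A_def)
  obtain as where "char_poly A = (\<Prod>a\<leftarrow>as. [:- a, 1:])"
    using char_poly_factorized[OF A] by blast
  from jordan_nf_exists[OF A this] obtain n_as where nf: "jordan_nf A n_as" by blast
  define B where "B = jordan_matrix n_as"
  from nf obtain P Q where wit: "similar_mat_wit A B P Q"
    unfolding jordan_nf_def similar_mat_def B_def by blast
  note W = similar_mat_witD2[OF A wit]
  have N: "sum_list (map fst n_as) = n" using W(5) unfolding B_def by auto
  have AP: "A * P = P * B"
  proof -
    have "A * P = P * B * (Q * P)" unfolding W(3)
      using W(5-7) by (simp add: assoc_mult_mat[of _ n n _ n _ n])
    then show ?thesis using W by simp
  qed
  have QA: "Q * A = B * Q"
  proof -
    have "Q * A = Q * P * B * Q" unfolding W(3)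
      using W(5-7) by (simp add: assoc_mult_mat[of _ n n _ n _ n])
    then show ?thesis using W by simp
  qed
  have prod: "(X * Y) $$ (i, j) = (\<Sum>a<n. X $$ (i, a) * Y $$ (a, j))"
    if "X \<in> carrier_mat n n" "Y \<in> carrier_mat n n" "i < n" "j < n" for X Y :: "complex mat" and i j
    using that by (simp add: scalar_prod_def atLeast0LessThan)
  show thesis
  proof (rule that[of "\<lambda>i j. P $$ (i, j)" "\<lambda>i j. Q $$ (i, j)" "\<lambda>i j. B $$ (i, j)"])
    fix i j assume ij: "i < n" "j < n"
    show "(\<Sum>a<n. P $$ (i, a) * Q $$ (a, j)) = of_bool (i = j)"
      unfolding prod[OF W(6,7) ij, symmetric] W(1) using ij by simp
    show "(\<Sum>a<n. Q $$ (i, a) * P $$ (a, j)) = of_bool (i = j)"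
      unfolding prod[OF W(7,6) ij, symmetric] W(2) using ij by simp
    have "(\<Sum>a<n. D i a * P $$ (a, j)) = (A * P) $$ (i, j)"
      unfolding prod[OF A W(6) ij] using ij by (intro sum.cong) (auto simp: A_def)
    then show "(\<Sum>a<n. D i a * P $$ (a, j)) = (\<Sum>a<n. P $$ (i, a) * B $$ (a, j))"
      unfolding AP prod[OF W(6,5) ij] .
    have "(\<Sum>a<n. Q $$ (i, a) * D a j) = (Q * A) $$ (i, j)"
      unfolding prod[OF W(7) A ij] using ij by (intro sum.cong) (auto simp: A_def)
    then show "(\<Sum>a<n. Q $$ (i, a) * D a j) = (\<Sum>a<n. B $$ (i, a) * Q $$ (a, j))"
      unfolding QA prod[OF W(5,7) ij] .
    show "i \<le> j \<and> B $$ (i, i) = B $$ (j, j)" if "B $$ (i, j) \<noteq> 0"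
      using jordan_matrix_entry_nonzero[of i n_as j] that ij N unfolding B_def by simp
  qed
qed

text \<open>
  The Lie algebra action of \<open>(X, Y, Z)\<close> on a tensor with three lower indices, one operator for each
  index.  An operator \<open>D\<close> acts on an upper index as \<open>-D\<^sup>T\<close> acts on a lower one; treating all
  indices alike makes one change-of-basis lemma enough, as
  \<open>tensor_annihilated_rotate\<close> moves any index into the first place.
\<close>

definition tensor_annihilated ::
    "nat \<Rightarrow> (nat \<Rightarrow> nat \<Rightarrow> complex) \<Rightarrow> (nat \<Rightarrow> nat \<Rightarrow> complex) \<Rightarrow> (nat \<Rightarrow> nat \<Rightarrow> complex) \<Rightarrow>
      (nat \<Rightarrow> nat \<Rightarrow> nat \<Rightarrow> complex) \<Rightarrow> bool" where
  "tensor_annihilated n X Y Z t \<longleftrightarrow> (\<forall>a<n. \<forall>b<n. \<forall>c<n.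
     (\<Sum>d<n. X d a * t d b c) + (\<Sum>d<n. Y d b * t a d c) + (\<Sum>d<n. Z d c * t a b d) = 0)"

lemma tensor_annihilated_rotate:
  "tensor_annihilated n X Y Z t \<longleftrightarrow> tensor_annihilated n Y Z X (\<lambda>b c a. t a b c)"
  unfolding tensor_annihilated_def by (simp add: add.commute add.left_commute) blast

lemma tensor_annihilated_cong:
  assumes "tensor_annihilated n X Y Z t"
    and "\<And>a b c. a < n \<Longrightarrow> b < n \<Longrightarrow> c < n \<Longrightarrow> t a b c = t' a b c"
  shows "tensor_annihilated n X Y Z t'"
  using assms unfolding tensor_annihilated_def by simp

lemma tensor_annihilated_change_basis:
  assumes t: "tensor_annihilated n X Y Z t"
    and XP: "\<And>i j. i < n \<Longrightarrow> j < n \<Longrightarrow> (\<Sum>a<n. X i a * P a j) = (\<Sum>a<n. P i a * X' a j)"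
  shows "tensor_annihilated n X' Y Z (\<lambda>i b c. \<Sum>a<n. P a i * t a b c)"
  unfolding tensor_annihilated_def
proof (intro allI impI)
  fix i b c assume lt: "i < n" "b < n" "c < n"
  have "(\<Sum>d<n. X' d i * (\<Sum>a<n. P a d * t a b c)) = (\<Sum>a<n. (\<Sum>d<n. P a d * X' d i) * t a b c)"
    unfolding sum_distrib_left sum_distrib_right by (subst sum.swap) (simp add: mult_ac)
  also have "\<dots> = (\<Sum>a<n. (\<Sum>d<n. X a d * P d i) * t a b c)"
    using lt by (simp add: XP)
  also have "\<dots> = (\<Sum>a<n. P a i * (\<Sum>d<n. X d a * t d b c))"
    unfolding sum_distrib_left sum_distrib_right by (subst sum.swap) (simp add: mult_ac)
  finally have 1: "(\<Sum>d<n. X' d i * (\<Sum>a<n. P a d * t a b c)) = (\<Sum>a<n. P a i * (\<Sum>d<n. X d a * t d b c))" .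
  have 2: "(\<Sum>d<n. Y d b * (\<Sum>a<n. P a i * t a d c)) = (\<Sum>a<n. P a i * (\<Sum>d<n. Y d b * t a d c))"
    unfolding sum_distrib_left by (subst sum.swap) (simp add: mult_ac)
  have 3: "(\<Sum>d<n. Z d c * (\<Sum>a<n. P a i * t a b d)) = (\<Sum>a<n. P a i * (\<Sum>d<n. Z d c * t a b d))"
    unfolding sum_distrib_left by (subst sum.swap) (simp add: mult_ac)
  show "(\<Sum>d<n. X' d i * (\<Sum>a<n. P a d * t a b c)) + (\<Sum>d<n. Y d b * (\<Sum>a<n. P a i * t a d c))
      + (\<Sum>d<n. Z d c * (\<Sum>a<n. P a i * t a b d)) = 0"
    unfolding 1 2 3 sum.distrib[symmetric] distrib_left[symmetric]
    using t lt by (simp add: tensor_annihilated_def)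
qed


text \<open>
  The triple acts on the \<open>(a, b, c)\<close> component by the weight \<open>X a a + Y b b + Z c c\<close> plus off-diagonal
  terms.  These involve only components of the same weight that come earlier in the order given by
  \<open>a + b + (n - c)\<close>, so by induction a component of nonzero weight vanishes.
\<close>

lemma tensor_annihilated_weight_zero:
  assumes t: "tensor_annihilated n X Y Z t"
    and X: "\<And>d a. d < n \<Longrightarrow> a < n \<Longrightarrow> X d a \<noteq> 0 \<Longrightarrow> d \<le> a \<and> X d d = X a a"
    and Y: "\<And>d b. d < n \<Longrightarrow> b < n \<Longrightarrow> Y d b \<noteq> 0 \<Longrightarrow> d \<le> b \<and> Y d d = Y b b"
    and Z: "\<And>d c. d < n \<Longrightarrow> c < n \<Longrightarrow> Z d c \<noteq> 0 \<Longrightarrow> c \<le> d \<and> Z d d = Z c c"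
    and "a < n" "b < n" "c < n" "X a a + Y b b + Z c c \<noteq> 0"
  shows "t a b c = 0"
  using assms(5-)
proof (induction "a + b + (n - c)" arbitrary: a b c rule: less_induct)
  case less
  have 1: "(\<Sum>d<n. X d a * t d b c) = X a a * t a b c"
  proof (rule sum.remove[THEN trans, of _ a])
    have "X d a * t d b c = 0" if "d \<in> {..<n} - {a}" for d
    proof (cases "X d a = 0")
      case False
      with X[of d a] less.prems that have "d < a" "d < n" "X d d = X a a" by auto
      then show ?thesis using less.hyps[of d b c] less.prems by auto
    qed simp
    then show "X a a * t a b c + (\<Sum>d\<in>{..<n} - {a}. X d a * t d b c) = X a a * t a b c"
      by (simp add: sum.neutral)
  qed (use less.prems in auto)
  have 2: "(\<Sum>d<n. Y d b * t a d c) = Y b b * t a b c"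
  proof (rule sum.remove[THEN trans, of _ b])
    have "Y d b * t a d c = 0" if "d \<in> {..<n} - {b}" for d
    proof (cases "Y d b = 0")
      case False
      with Y[of d b] less.prems that have "d < b" "d < n" "Y d d = Y b b" by auto
      then show ?thesis using less.hyps[of a d c] less.prems by auto
    qed simp
    then show "Y b b * t a b c + (\<Sum>d\<in>{..<n} - {b}. Y d b * t a d c) = Y b b * t a b c"
      by (simp add: sum.neutral)
  qed (use less.prems in auto)
  have 3: "(\<Sum>d<n. Z d c * t a b d) = Z c c * t a b c"
  proof (rule sum.remove[THEN trans, of _ c])
    have "Z d c * t a b d = 0" if "d \<in> {..<n} - {c}" for d
    proof (cases "Z d c = 0")
      case False
      with Z[of d c] less.prems that have "c < d" "d < n" "Z d d = Z c c" by auto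
      then show ?thesis using less.hyps[of a b d] less.prems by auto
    qed simp
    then show "Z c c * t a b c + (\<Sum>d\<in>{..<n} - {c}. Z d c * t a b d) = Z c c * t a b c"
      by (simp add: sum.neutral)
  qed (use less.prems in auto)
  have "(X a a + Y b b + Z c c) * t a b c = 0"
    using t[unfolded tensor_annihilated_def, rule_format, OF less.prems(1-3)]
    unfolding 1 2 3 distrib_right .
  then show ?case using less.prems(4) by simp
qed

text \<open>
  Undoes a change of basis in the first index, with \<open>Q\<close> inverse to \<open>P\<close>, after the operator has been
  replaced by another one.
\<close>

lemma tensor_annihilated_change_basis_cancel:
  assumes t: "tensor_annihilated n X Y Z (\<lambda>i b c. \<Sum>a<n. P a i * t a b c)"
    and XQ: "\<And>i j. i < n \<Longrightarrow> j < n \<Longrightarrow> (\<Sum>a<n. X i a * Q a j) = (\<Sum>a<n. Q i a * X' a j)"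
    and PQ: "\<And>i j. i < n \<Longrightarrow> j < n \<Longrightarrow> (\<Sum>a<n. P i a * Q a j) = of_bool (i = j)"
  shows "tensor_annihilated n X' Y Z t"
proof (rule tensor_annihilated_cong[OF tensor_annihilated_change_basis[OF t XQ]])
  fix i b c assume lt: "i < n" "b < n" "c < n"
  have "(\<Sum>a<n. Q a i * (\<Sum>d<n. P d a * t d b c)) = (\<Sum>d<n. (\<Sum>a<n. P d a * Q a i) * t d b c)"
    unfolding sum_distrib_left sum_distrib_right by (subst sum.swap) (simp add: mult_ac)
  also have "\<dots> = (\<Sum>d<n. of_bool (d = i) * t d b c)"
    using lt by (simp add: PQ)
  also have "\<dots> = t i b c"
    using lt by (simp add: of_bool_def if_distrib[of "\<lambda>x. x * _"] cong: if_cong)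
  finally show "(\<Sum>a<n. Q a i * (\<Sum>d<n. P d a * t d b c)) = t i b c" .
qed

text \<open>
  If \<open>D\<close> is a derivation of the bracket with structure constants \<open>t\<close>, then so is the operator \<open>Y\<close>
  that multiplies each Jordan basis vector by the conjugate of its eigenvalue.  In the Jordan basis
  the components of \<open>t\<close> with \<open>J a a + J b b \<noteq> J c c\<close> vanish.  Conjugation is
  additive, so these include all components on which the conjugated diagonal operator would act by
  a nonzero weight.
\<close>

lemma tensor_annihilated_conjugate_semisimple_part:
  fixes P Q J D :: "nat \<Rightarrow> nat \<Rightarrow> complex" and n :: nat
  defines "Y \<equiv> \<lambda>a b. \<Sum>i<n. P a i * cnj (J i i) * Q i b"
  assumes t: "tensor_annihilated n D D (\<lambda>d c. - D c d) t"
    and PQ: "\<And>i j. i < n \<Longrightarrow> j < n \<Longrightarrow> (\<Sum>a<n. P i a * Q a j) = of_bool (i = j)"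
    and QP: "\<And>i j. i < n \<Longrightarrow> j < n \<Longrightarrow> (\<Sum>a<n. Q i a * P a j) = of_bool (i = j)"
    and DP: "\<And>i j. i < n \<Longrightarrow> j < n \<Longrightarrow> (\<Sum>a<n. D i a * P a j) = (\<Sum>a<n. P i a * J a j)"
    and QD: "\<And>i j. i < n \<Longrightarrow> j < n \<Longrightarrow> (\<Sum>a<n. Q i a * D a j) = (\<Sum>a<n. J i a * Q a j)"
    and J: "\<And>i j. i < n \<Longrightarrow> j < n \<Longrightarrow> J i j \<noteq> 0 \<Longrightarrow> i \<le> j \<and> J i i = J j j"
  shows "tensor_annihilated n Y Y (\<lambda>d c. - Y c d) t"
proof -
  define L where "L i j = of_bool (i = j) * cnj (J i i)" for i j
  have delta: "(\<Sum>a<n. of_bool (i = a) * f a) = f i" "(\<Sum>a<n. of_bool (a = i) * f a) = f i"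
    "(\<Sum>a<n. f a * of_bool (i = a)) = f i" "(\<Sum>a<n. f a * of_bool (a = i)) = f i"
    if "i < n" for i and f :: "nat \<Rightarrow> complex"
    using that by (simp_all add: of_bool_def if_distrib[of "\<lambda>x. x * _"] if_distrib[of "\<lambda>x. _ * x"] cong: if_cong)
  have LQ: "(\<Sum>a<n. L i a * Q a j) = (\<Sum>a<n. Q i a * Y a j)" if "i < n" "j < n" for i j
  proof -
    have "(\<Sum>a<n. Q i a * Y a j) = (\<Sum>k<n. (\<Sum>a<n. Q i a * P a k) * (cnj (J k k) * Q k j))"
      unfolding Y_def sum_distrib_left sum_distrib_right by (subst sum.swap) (simp add: mult_ac)
    also have "\<dots> = cnj (J i i) * Q i j" using that by (simp add: QP delta)
    also have "\<dots> = (\<Sum>a<n. L i a * Q a j)" using that by (simp add: L_def mult.assoc delta)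
    finally show ?thesis ..
  qed
  have PL: "(\<Sum>a<n. P i a * L a j) = (\<Sum>a<n. Y i a * P a j)" if "i < n" "j < n" for i j
  proof -
    have "(\<Sum>a<n. Y i a * P a j) = (\<Sum>k<n. P i k * cnj (J k k) * (\<Sum>a<n. Q k a * P a j))"
      unfolding Y_def sum_distrib_left sum_distrib_right by (subst sum.swap) (simp add: mult_ac)
    also have "\<dots> = P i j * cnj (J j j)" using that by (simp add: QP delta)
    also have "\<dots> = (\<Sum>a<n. P i a * L a j)"
      using that by (simp add: L_def mult.left_commute[of "P _ _"] delta)
    finally show ?thesis ..
  qed
  \<comment> \<open>The tensor with one, two and all three indices expressed in the Jordan basis, rotated after each step.\<close>
  let ?t1 = "\<lambda>b c i. \<Sum>a<n. P a i * t a b c"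
  let ?t2 = "\<lambda>c i j. \<Sum>b<n. P b j * ?t1 b c i"
  let ?t3 = "\<lambda>i j k. \<Sum>c<n. Q k c * ?t2 c i j"
  let ?D' = "\<lambda>d c. - D c d" and ?J' = "\<lambda>d c. - J c d" and ?L' = "\<lambda>d c. - L c d" and ?Y' = "\<lambda>d c. - Y c d"
  have "tensor_annihilated n D ?D' J ?t1"
    by (subst tensor_annihilated_rotate[symmetric]) (rule tensor_annihilated_change_basis[OF t DP])
  then have "tensor_annihilated n ?D' J J ?t2"
    by (subst tensor_annihilated_rotate[symmetric]) (erule tensor_annihilated_change_basis[OF _ DP])
  define T where "T = ?t3"
  from \<open>tensor_annihilated n ?D' J J ?t2\<close> have t3: "tensor_annihilated n J J ?J' T" unfolding T_def
  proof (subst tensor_annihilated_rotate[symmetric], elim tensor_annihilated_change_basis)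
    fix i j assume lt: "i < n" "j < n"
    show "(\<Sum>a<n. ?D' i a * Q j a) = (\<Sum>a<n. Q a i * ?J' a j)"
      using QD[OF lt(2,1)] by (simp add: sum_negf mult.commute)
  qed
  have weights: "cnj (J a a) + cnj (J b b) - cnj (J c c) = 0 \<or> T a b c = 0"
    if "a < n" "b < n" "c < n" for a b c
  proof (cases "J a a + J b b - J c c = 0")
    case True
    then show ?thesis by (metis complex_cnj_add complex_cnj_diff complex_cnj_zero)
  next
    case False
    have "T a b c = 0"
      by (rule tensor_annihilated_weight_zero[OF t3 J J _ that]) (use J False in auto)
    then show ?thesis ..
  qed
  have "tensor_annihilated n L L ?L' T"
    unfolding tensor_annihilated_def
  proof (intro allI impI)
    fix a b c assume lt: "a < n" "b < n" "c < n"
    have "(\<Sum>d<n. L d a * T d b c) + (\<Sum>d<n. L d b * T a d c) + (\<Sum>d<n. ?L' d c * T a b d) =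
      (cnj (J a a) + cnj (J b b) - cnj (J c c)) * T a b c"
      using lt by (simp add: L_def mult.assoc delta sum_negf ring_distribs)
    then show "(\<Sum>d<n. L d a * T d b c) + (\<Sum>d<n. L d b * T a d c) + (\<Sum>d<n. ?L' d c * T a b d) = 0"
      using weights[OF lt] by auto
  qed
  \<comment> \<open>Return to the original basis, one index at a time and in the opposite order.\<close>
  then have "tensor_annihilated n ?L' L L (\<lambda>k i j. \<Sum>c<n. Q k c * ?t2 c i j)"
    unfolding T_def by (rule tensor_annihilated_rotate[THEN iffD2])
  then have "tensor_annihilated n ?Y' L L ?t2"
  proof (rule tensor_annihilated_change_basis_cancel[where P = "\<lambda>a i. Q i a" and Q = "\<lambda>a i. P i a"])
    fix i j assume lt: "i < n" "j < n"
    show "(\<Sum>a<n. ?L' i a * P j a) = (\<Sum>a<n. P a i * ?Y' a j)"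
      using PL[OF lt(2,1)] by (simp add: sum_negf mult.commute)
    show "(\<Sum>a<n. Q a i * P j a) = of_bool (i = j)"
      using PQ[OF lt(2,1)] unfolding mult.commute[of "P _ _"] eq_commute[of j i] .
  qed
  then have "tensor_annihilated n L ?Y' L (\<lambda>j c i. \<Sum>b<n. P b j * ?t1 b c i)"
    by (rule tensor_annihilated_rotate[THEN iffD2])
  then have "tensor_annihilated n Y ?Y' L ?t1"
    by (rule tensor_annihilated_change_basis_cancel[OF _ LQ PQ])
  then have "tensor_annihilated n L Y ?Y' (\<lambda>i b c. \<Sum>a<n. P a i * t a b c)"
    by (rule tensor_annihilated_rotate[THEN iffD2])
  then show ?thesis
    by (rule tensor_annihilated_change_basis_cancel[OF _ LQ PQ])
qed

lemma trace_conjugate_semisimple_part: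
  fixes P Q J D :: "nat \<Rightarrow> nat \<Rightarrow> complex" and n :: nat
  defines "Y \<equiv> \<lambda>a b. \<Sum>i<n. P a i * cnj (J i i) * Q i b"
  assumes QP: "\<And>i j. i < n \<Longrightarrow> j < n \<Longrightarrow> (\<Sum>a<n. Q i a * P a j) = of_bool (i = j)"
    and DP: "\<And>i j. i < n \<Longrightarrow> j < n \<Longrightarrow> (\<Sum>a<n. D i a * P a j) = (\<Sum>a<n. P i a * J a j)"
  shows "(\<Sum>a<n. \<Sum>c<n. D a c * Y c a) = of_real (\<Sum>i<n. (cmod (J i i))\<^sup>2)"
proof -
  have "(\<Sum>a<n. \<Sum>c<n. D a c * Y c a) = (\<Sum>a<n. \<Sum>i<n. (\<Sum>c<n. D a c * P c i) * (cnj (J i i) * Q i a))"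
    unfolding Y_def sum_distrib_left sum_distrib_right
    by (rule sum.cong[OF refl], subst sum.swap) (simp add: mult_ac)
  also have "\<dots> = (\<Sum>a<n. \<Sum>i<n. \<Sum>k<n. (P a k * J k i) * (cnj (J i i) * Q i a))"
    by (simp add: DP sum_distrib_right)
  also have "\<dots> = (\<Sum>i<n. \<Sum>k<n. (\<Sum>a<n. Q i a * P a k) * (J k i * cnj (J i i)))"
    unfolding sum_distrib_right
    by (subst sum.swap, rule sum.cong[OF refl], subst sum.swap) (simp add: mult_ac)
  also have "\<dots> = (\<Sum>i<n. \<Sum>k<n. of_bool (i = k) * (J k i * cnj (J i i)))"
    by (simp add: QP)
  also have "\<dots> = (\<Sum>i<n. J i i * cnj (J i i))"
    by (simp add: of_bool_def if_distrib[of "\<lambda>x. x * _"] cong: if_cong)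
  also have "\<dots> = of_real (\<Sum>i<n. (cmod (J i i))\<^sup>2)"
    by (simp only: of_real_sum complex_norm_square)
  finally show ?thesis .
qed

section \<open>Coordinates and traces in finite-dimensional real vector spaces\<close>

lemma finite_dimensional_from_finite_span:
  fixes B :: "'a::real_vector set"
  assumes "finite B" "span B = UNIV"
  obtains C :: "'a set" where "finite C" "independent C" "span C = UNIV"
    "finite_dimensional_vector_space (scaleR :: real \<Rightarrow> 'a \<Rightarrow> 'a) C"
proof -
  obtain C where C: "C \<subseteq> B" "independent C" "B \<subseteq> span C"
    using real_vector.maximal_independent_subset by blast
  have fin: "finite C" using C(1) assms(1) finite_subset by blast
  have sp: "span C = UNIV"
    using C(3) assms(2) by (metis span_mono span_span top.extremum_uniqueI)
  have "finite_dimensional_vector_space (scaleR :: real \<Rightarrow> 'a \<Rightarrow> 'a) C"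
    by unfold_locales
      (use fin C(2) sp in \<open>simp_all add: dependent_raw_def span_raw_def scaleR_right_distrib scaleR_left_distrib\<close>)
  then show thesis using that fin C(2) sp by blast
qed

text \<open>
  Transfers the dimension theory of finite-dimensional spaces, which is stated relative to a fixed
  basis, to a real vector space about which only the existence of a finite spanning set is known.
\<close>

locale finite_dim =
  assumes finite_span: "\<exists>B :: 'a::real_vector set. finite B \<and> span B = UNIV"
begin

lemma dim_mono: "S \<subseteq> T \<Longrightarrow> dim S \<le> dim (T :: 'a set)"
proof -
  assume "S \<subseteq> T"
  obtain C where "finite_dimensional_vector_space (scaleR :: real \<Rightarrow> 'a \<Rightarrow> 'a) C"
    using finite_span finite_dimensional_from_finite_span by blast
  then interpret fd: finite_dimensional_vector_space "scaleR :: real \<Rightarrow> 'a \<Rightarrow> 'a" C .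
  show ?thesis using fd.dim_subset[OF \<open>S \<subseteq> T\<close>] by (simp add: dim_raw_def)
qed

lemma subspace_eqI_dim:
  assumes "subspace S" "subspace T" "S \<subseteq> T" "dim T \<le> dim (S :: 'a set)"
  shows "S = T"
proof -
  obtain C where "finite_dimensional_vector_space (scaleR :: real \<Rightarrow> 'a \<Rightarrow> 'a) C"
    using finite_span finite_dimensional_from_finite_span by blast
  then interpret fd: finite_dimensional_vector_space "scaleR :: real \<Rightarrow> 'a \<Rightarrow> 'a" C .
  show ?thesis
    using fd.subspace_dim_equal[of S T] assms by (simp add: dim_raw_def subspace_raw_def)
qed

lemma injective_endomorphism_surj:
  assumes "linear (f :: 'a \<Rightarrow> 'a)" "\<And>x. f x = 0 \<Longrightarrow> x = 0"
  shows "surj f"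
proof -
  obtain C where "finite_dimensional_vector_space (scaleR :: real \<Rightarrow> 'a \<Rightarrow> 'a) C"
    using finite_span finite_dimensional_from_finite_span by blast
  then interpret fd: finite_dimensional_vector_space "scaleR :: real \<Rightarrow> 'a \<Rightarrow> 'a" C .
  interpret fd2: finite_dimensional_vector_space_pair "scaleR :: real \<Rightarrow> 'a \<Rightarrow> 'a" C
    "scaleR :: real \<Rightarrow> 'a \<Rightarrow> 'a" C by unfold_locales
  have "inj f" using assms linear_injective_0 by blast
  then show ?thesis
    using fd2.linear_injective_imp_surjective[of f] assms(1) by (simp add: linear_def)
qed

end

text \<open>
  A basis \<open>e\<close> with its coordinate functions, indexed by natural numbers so that operators become
  arrays and traces become sums.
\<close>

locale coordinates =
  fixes n :: nat and e :: "nat \<Rightarrow> 'a::real_vector" and co :: "'a \<Rightarrow> nat \<Rightarrow> real"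
  assumes co_linear: "linear (\<lambda>v. co v i)"
    and expand: "(\<Sum>i<n. co v i *\<^sub>R e i) = v"
    and co_basis: "i < n \<Longrightarrow> j < n \<Longrightarrow> co (e i) j = of_bool (i = j)"
begin

lemmas co_simps = linear_add[OF co_linear] linear_diff[OF co_linear] linear_scale[OF co_linear]
  linear_0[OF co_linear] linear_neg[OF co_linear] linear_sum[OF co_linear]

definition tr :: "('a \<Rightarrow> 'a) \<Rightarrow> real" where
  "tr f = (\<Sum>i<n. co (f (e i)) i)"

lemma tr_add: "tr (\<lambda>v. f v + g v) = tr f + tr g"
  by (simp add: tr_def co_simps sum.distrib)

lemma tr_diff: "tr (\<lambda>v. f v - g v) = tr f - tr g"
  by (simp add: tr_def co_simps sum_subtractf)

lemma tr_scale: "tr (\<lambda>v. c *\<^sub>R f v) = c * tr f"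
  by (simp add: tr_def co_simps sum_distrib_left)

lemma tr_zero: "tr (\<lambda>v. 0) = 0"
  by (simp add: tr_def co_simps)

lemma linear_expand:
  assumes "linear f"
  shows "f v = (\<Sum>j<n. co v j *\<^sub>R f (e j))"
  by (subst expand[symmetric, of v]) (simp add: linear_sum[OF assms] linear_scale[OF assms])

lemma co_linear_image: "linear f \<Longrightarrow> co (f v) i = (\<Sum>j<n. co v j * co (f (e j)) i)"
  by (subst linear_expand) (simp_all add: co_simps)

lemma tr_comp_eq:
  assumes "linear f"
  shows "tr (\<lambda>v. f (g v)) = (\<Sum>i<n. \<Sum>j<n. co (f (e j)) i * co (g (e i)) j)"
  unfolding tr_def by (subst co_linear_image[OF assms]) (simp add: mult.commute)

lemma tr_comp_commute:
  assumes "linear f" "linear g"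
  shows "tr (\<lambda>v. f (g v)) = tr (\<lambda>v. g (f v))"
  unfolding tr_comp_eq[OF assms(1)] tr_comp_eq[OF assms(2)]
  by (subst sum.swap) (simp add: mult.commute)

lemma linear_eqI: "linear f \<Longrightarrow> linear g \<Longrightarrow> (\<And>i. i < n \<Longrightarrow> f (e i) = g (e i)) \<Longrightarrow> f v = g v"
  by (subst linear_expand, assumption, subst (2) linear_expand, assumption) simp

lemma coordinates_eqI: "(\<And>i. i < n \<Longrightarrow> co u i = co v i) \<Longrightarrow> u = v"
  by (subst (1 2) expand[symmetric]) simp

lemma co_sum: "i < n \<Longrightarrow> co (\<Sum>j<n. x j *\<^sub>R e j) i = x i"
  by (simp add: co_simps co_basis of_bool_def if_distrib[of "\<lambda>x. _ * x"] cong: if_cong)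

end

lemma (in finite_dim) coordinates_exist:
  obtains n and e :: "nat \<Rightarrow> 'a" and co where "coordinates n e co"
proof -
  obtain C :: "'a set" where C: "finite C" "independent C" "span C = UNIV"
    using finite_span finite_dimensional_from_finite_span by metis
  obtain e where e: "bij_betw e {..<card C} C"
    using ex_bij_betw_nat_finite[OF C(1)] by (auto simp: atLeast0LessThan)
  let ?co = "\<lambda>v i. representation C v (e i)"
  show thesis
  proof (rule that[of "card C" e ?co], rule coordinates.intro)
    show "linear (\<lambda>v. ?co v i)" for i
      by (rule linearI) (use C in \<open>simp_all add: real_vector.representation_add real_vector.representation_scale\<close>)
    show "(\<Sum>i<card C. ?co v i *\<^sub>R e i) = v" for v
    proof -
      have "(\<Sum>i<card C. ?co v i *\<^sub>R e i) = (\<Sum>b\<in>C. representation C v b *\<^sub>R b)"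
        by (rule sum.reindex_bij_betw[OF e])
      also have "\<dots> = v"
        using C by (intro real_vector.sum_representation_eq) auto
      finally show ?thesis .
    qed
    show "?co (e i) j = of_bool (i = j)" if "i < card C" "j < card C" for i j
    proof -
      have "e i \<in> C" using e that by (auto simp: bij_betw_def)
      moreover have "e i = e j \<longleftrightarrow> i = j"
        using e that by (auto simp: bij_betw_def inj_on_def)
      ultimately show ?thesis
        using C by (auto simp: real_vector.representation_basis)
    qed
  qed
qed

section \<open>Lie brackets and Engel's theorem\<close>

context lie_algebra
begin

lemmas br_simps = bilinear_ladd[OF bilinear_br] bilinear_radd[OF bilinear_br]
  bilinear_lmul[OF bilinear_br] bilinear_rmul[OF bilinear_br]
  bilinear_lzero[OF bilinear_br] bilinear_rzero[OF bilinear_br]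
  bilinear_lsub[OF bilinear_br] bilinear_rsub[OF bilinear_br]
  bilinear_lneg[OF bilinear_br] bilinear_rneg[OF bilinear_br] br_self

lemma linear_br: "linear (br x)" and linear_br_left: "linear (\<lambda>x. br x y)"
  using bilinear_br by (auto simp: bilinear_def)

lemma br_anti: "br x y = - br y x"
proof -
  have "br (x + y) (x + y) = br x y + br y x"
    by (simp only: bilinear_ladd[OF bilinear_br] bilinear_radd[OF bilinear_br]) (simp add: br_self)
  then show ?thesis unfolding br_self by (simp add: eq_neg_iff_add_eq_0)
qed

lemma br_leibniz: "br x (br y z) = br (br x y) z + br y (br x z)"
  using jacobi[of x y z] br_anti[of z "br x y"] br_anti[of z x]
  by (simp add: br_simps) (simp add: algebra_simps eq_neg_iff_add_eq_0)

end

context fin_dim_lie_algebra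
begin

sublocale finite_dim by unfold_locales (rule fin_dim)

text \<open>
  Engel's theorem for the adjoint representation: on the quotient \<open>W / U\<close> of two invariant
  subspaces, a subalgebra \<open>S\<close> of ad-nilpotent elements has a nonzero common null vector.  Working with
  pairs \<open>U \<subseteq> W\<close> avoids quotient spaces and lets the induction hypothesis for a smaller subalgebra
  \<open>M\<close> be used twice: for the pair \<open>M \<subseteq> S\<close>, and for \<open>U \<subseteq> W\<close>.
\<close>

lemma engel:
  assumes "subspace S" "\<And>x y. x \<in> S \<Longrightarrow> y \<in> S \<Longrightarrow> br x y \<in> S"
    and "\<And>x w. x \<in> S \<Longrightarrow> \<exists>m. (br x ^^ m) w = 0"
    and "subspace U" "subspace W" "U \<subseteq> W" "U \<noteq> W"
    and "\<And>x w. x \<in> S \<Longrightarrow> w \<in> W \<Longrightarrow> br x w \<in> W"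
    and "\<And>x u. x \<in> S \<Longrightarrow> u \<in> U \<Longrightarrow> br x u \<in> U"
  shows "\<exists>w\<in>W - U. \<forall>x\<in>S. br x w \<in> U"
  using assms
proof (induction "dim S" arbitrary: S U W rule: less_induct)
  case less
  note S = less.prems(1-3) and UW = less.prems(4-9)
  show ?case
  proof (cases "S = {0}")
    case True
    then show ?thesis using UW(1,3,4) by (auto simp: br_simps subspace_0)
  next
    case False
    define sub where "sub M \<longleftrightarrow> subspace M \<and> (\<forall>x\<in>M. \<forall>y\<in>M. br x y \<in> M) \<and> M \<subset> S" for M
    have "sub {0}"
      using False subspace_0[OF S(1)] by (auto simp: sub_def br_simps)
    moreover have "\<forall>M. sub M \<longrightarrow> dim M < Suc (dim S)"
      using dim_mono by (auto simp: sub_def less_Suc_eq_le)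
    ultimately obtain M where M: "sub M" and max: "\<And>N. sub N \<Longrightarrow> dim N \<le> dim M"
      using ex_has_greatest_nat[of sub "{0}" dim "Suc (dim S)"] by (metis less_imp_le)
    have Msub: "subspace M" and Mbr: "\<And>x y. x \<in> M \<Longrightarrow> y \<in> M \<Longrightarrow> br x y \<in> M" and MS: "M \<subset> S"
      using M by (auto simp: sub_def)
    have dim: "dim M < dim S"
      using subspace_eqI_dim[OF Msub S(1)] MS by (metis leI order.strict_iff_order)
    \<comment> \<open>A null vector of M on S / M normalizes M; by maximality of M it spans S together with M.\<close>
    have "\<exists>x\<in>S - M. \<forall>m\<in>M. br m x \<in> M"
      by (rule less.hyps[OF dim]) (use Msub Mbr MS S in auto)
    then obtain x where x: "x \<in> S" "x \<notin> M" and xM: "\<And>m. m \<in> M \<Longrightarrow> br m x \<in> M" by blast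
    have Mx: "br x m \<in> M" if "m \<in> M" for m
      using xM[OF that] subspace_neg[OF Msub] br_anti[of x m] by simp
    have "\<exists>w\<in>W - U. \<forall>m\<in>M. br m w \<in> U"
      by (rule less.hyps[OF dim]) (use Msub Mbr MS S UW in auto)
    then obtain w where w: "w \<in> W" "w \<notin> U" and Mw: "\<And>m. m \<in> M \<Longrightarrow> br m w \<in> U" by blast
    define N where "N = span (insert x M)"
    have N_decomp: "\<exists>c m. m \<in> M \<and> y = m + c *\<^sub>R x" if y: "y \<in> N" for y
    proof -
      obtain c where "y - c *\<^sub>R x \<in> span M"
        using y[unfolded N_def span_breakdown_eq] by blast
      then have "y - c *\<^sub>R x \<in> M" using span_eq_iff Msub by blast
      then show ?thesis by (intro exI[of _ c] exI[of _ "y - c *\<^sub>R x"]) simp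
    qed
    have MN: "M \<subseteq> N" and xN: "x \<in> N" by (auto simp: N_def span_base)
    have NS: "N \<subseteq> S"
      unfolding N_def using x(1) MS S(1) by (intro span_minimal) auto
    have "S = N"
    proof (rule ccontr)
      assume "S \<noteq> N"
      have "sub N"
        unfolding sub_def
      proof (intro conjI ballI)
        show "subspace N" by (simp add: N_def)
        show "N \<subset> S" using NS \<open>S \<noteq> N\<close> by blast
        fix y z assume "y \<in> N" "z \<in> N"
        then obtain c m d k where "m \<in> M" "y = m + c *\<^sub>R x" "k \<in> M" "z = k + d *\<^sub>R x"
          using N_decomp by metis
        then have "br y z = br m k + d *\<^sub>R br m x + c *\<^sub>R br x k" by (simp add: br_simps)
        also have "\<dots> \<in> M"
          using \<open>m \<in> M\<close> \<open>k \<in> M\<close> Mbr xM Mx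
          by (intro subspace_add[OF Msub] subspace_scale[OF Msub]) auto
        finally show "br y z \<in> N" using MN by blast
      qed
      then have "dim N \<le> dim M" by (rule max)
      then have "M = N" using subspace_eqI_dim[OF Msub _ MN] by (simp add: N_def)
      then show False using xN x(2) by blast
    qed
    \<comment> \<open>x preserves the vectors of W that M maps into U, and some power of x maps w into U: stop just before.\<close>
    have iter: "(br x ^^ j) w \<in> W \<and> (\<forall>m\<in>M. br m ((br x ^^ j) w) \<in> U)" for j
    proof (induction j)
      case 0
      then show ?case using w Mw by simp
    next
      case (Suc j)
      let ?v = "(br x ^^ j) w"
      have "br m (br x ?v) \<in> U" if "m \<in> M" for m
        unfolding br_leibniz[of m x]
        using Suc.IH that xM x(1) UW(6) by (intro subspace_add[OF UW(1)]) auto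
      then show ?case using Suc.IH UW(5) x(1) by simp
    qed
    define j where "j = (LEAST j. (br x ^^ j) w \<in> U)"
    have "\<exists>j. (br x ^^ j) w \<in> U"
      using S(3)[OF x(1), of w] subspace_0[OF UW(1)] by metis
    then have j: "(br x ^^ j) w \<in> U" "\<And>i. i < j \<Longrightarrow> (br x ^^ i) w \<notin> U"
      unfolding j_def by (auto intro: LeastI_ex dest: not_less_Least)
    have "j \<noteq> 0" using j(1) w(2) by (metis funpow_0)
    then obtain i where i: "j = Suc i" by (cases j) auto
    let ?v = "(br x ^^ i) w"
    have "br y ?v \<in> U" if yS: "y \<in> S" for y
    proof -
      obtain c m where "m \<in> M" "y = m + c *\<^sub>R x" using N_decomp yS \<open>S = N\<close> by blast
      then show ?thesis
        using iter[of i] j(1) i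
        by (auto simp: br_simps intro!: subspace_add[OF UW(1)] subspace_scale[OF UW(1)])
    qed
    then show ?thesis using iter[of i] j(2)[of i] i by blast
  qed
qed

end

section \<open>Derivations and Cartan's criterion\<close>

definition (in lie_algebra) derivation :: "('a \<Rightarrow> 'a) \<Rightarrow> bool" where
  "derivation D \<longleftrightarrow> linear D \<and> (\<forall>x y. D (br x y) = br (D x) y + br x (D y))"

lemma (in lie_algebra) derivation_br: "derivation (br z)"
  unfolding derivation_def by (blast intro: linear_br br_leibniz)

locale lie_algebra_coordinates = fin_dim_lie_algebra br + coordinates n e co
  for br :: "'a::real_vector \<Rightarrow> 'a \<Rightarrow> 'a" and n :: nat and e :: "nat \<Rightarrow> 'a" and co :: "'a \<Rightarrow> nat \<Rightarrow> real"
begin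

lemma derivation_tensor_annihilated:
  assumes "derivation D"
  shows "tensor_annihilated n (\<lambda>i j. of_real (co (D (e j)) i)) (\<lambda>i j. of_real (co (D (e j)) i))
    (\<lambda>j i. - of_real (co (D (e j)) i)) (\<lambda>a b c. of_real (co (br (e a) (e b)) c))"
  unfolding tensor_annihilated_def
proof (intro allI impI)
  fix a b c
  have lin: "linear D" and der: "D (br x y) = br (D x) y + br x (D y)" for x y
    using assms by (auto simp: derivation_def)
  have "co (D (br (e a) (e b))) c = co (br (D (e a)) (e b)) c + co (br (e a) (D (e b))) c"
    by (simp add: der co_simps)
  then have "(\<Sum>d<n. co (D (e a)) d * co (br (e d) (e b)) c) + (\<Sum>d<n. co (D (e b)) d * co (br (e a) (e d)) c)
      + (\<Sum>d<n. - co (D (e d)) c * co (br (e a) (e b)) d) = 0"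
    unfolding co_linear_image[OF lin, of "br _ _"] co_linear_image[OF linear_br, of _ "D (e b)"]
      co_linear_image[OF linear_br_left, of "D (e a)"]
    by (simp add: sum_negf mult.commute)
  then have "complex_of_real ((\<Sum>d<n. co (D (e a)) d * co (br (e d) (e b)) c) + (\<Sum>d<n. co (D (e b)) d * co (br (e a) (e d)) c)
      + (\<Sum>d<n. - co (D (e d)) c * co (br (e a) (e b)) d)) = 0" by simp
  then show "(\<Sum>d<n. of_real (co (D (e a)) d) * complex_of_real (co (br (e d) (e b)) c))
      + (\<Sum>d<n. of_real (co (D (e b)) d) * of_real (co (br (e a) (e d)) c))
      + (\<Sum>d<n. - of_real (co (D (e d)) c) * of_real (co (br (e a) (e b)) d)) = 0" 
    by (simp only: of_real_add of_real_sum of_real_mult of_real_minus)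
qed

text \<open>
  The structure constants are real, so a complex matrix satisfies the linear equations for a derivation
  only if its real part does.
\<close>

lemma derivation_Re_of_annihilator:
  fixes y :: "nat \<Rightarrow> nat \<Rightarrow> complex"
  defines "Y \<equiv> \<lambda>v. \<Sum>i<n. (\<Sum>j<n. co v j * Re (y i j)) *\<^sub>R e i"
  assumes y: "tensor_annihilated n y y (\<lambda>j i. - y i j) (\<lambda>a b c. of_real (co (br (e a) (e b)) c))"
  shows "derivation Y" and "\<And>i j. i < n \<Longrightarrow> j < n \<Longrightarrow> co (Y (e j)) i = Re (y i j)"
proof -
  show entry: "co (Y (e j)) i = Re (y i j)" if "i < n" "j < n" for i j
    using that unfolding Y_def
    by (simp add: co_sum co_basis of_bool_def if_distrib[of "\<lambda>x. x * _"] cong: if_cong)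
  have lin: "linear Y"
    by (rule linearI) (simp_all add: Y_def co_simps distrib_right sum.distrib scaleR_add_left
        mult.assoc scaleR_right.sum sum_distrib_left[symmetric])
  have basis: "Y (br (e a) (e b)) = br (Y (e a)) (e b) + br (e a) (Y (e b))" if "a < n" "b < n" for a b
  proof (rule coordinates_eqI)
    fix c assume "c < n"
    have "Re ((\<Sum>d<n. y d a * of_real (co (br (e d) (e b)) c)) + (\<Sum>d<n. y d b * of_real (co (br (e a) (e d)) c))
      + (\<Sum>d<n. - y c d * of_real (co (br (e a) (e b)) d))) = 0"
      using y that \<open>c < n\<close> by (simp only: tensor_annihilated_def) simp
    then show "co (Y (br (e a) (e b))) c = co (br (Y (e a)) (e b) + br (e a) (Y (e b))) c"
      unfolding co_linear_image[OF lin, of "br _ _"] linear_add[OF co_linear]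
        co_linear_image[OF linear_br, of _ "Y (e b)"] co_linear_image[OF linear_br_left, of "Y (e a)"]
      using that \<open>c < n\<close> by (simp add: sum_negf mult.commute entry)
  qed
  have 1: "Y (br u (e b)) = br (Y u) (e b) + br u (Y (e b))" if "b < n" for u b
    by (rule linear_eqI[of "\<lambda>u. Y (br u (e b))" "\<lambda>u. br (Y u) (e b) + br u (Y (e b))"])
      (use basis that in \<open>simp_all add: linear_compose_add linear_br_left
        linear_compose[OF linear_br_left lin, unfolded comp_def]
        linear_compose[OF lin linear_br_left, unfolded comp_def]\<close>)
  have "Y (br u v) = br (Y u) v + br u (Y v)" for u v
    by (rule linear_eqI[of "\<lambda>v. Y (br u v)" "\<lambda>v. br (Y u) v + br u (Y v)"])
      (use 1 in \<open>simp_all add: linear_compose_add linear_br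
        linear_compose[OF linear_br lin, unfolded comp_def]
        linear_compose[OF lin linear_br, unfolded comp_def]\<close>)
  with lin show "derivation Y" by (simp add: derivation_def)
qed

text \<open>
  In the coordinates \<open>Q\<close> the operator \<open>D\<close> is strictly upper triangular, so each application of
  \<open>D\<close> kills one further coordinate, starting from the last.
\<close>

lemma nilpotent_of_triangular:
  assumes D: "linear D"
    and PQ: "\<And>i j. i < n \<Longrightarrow> j < n \<Longrightarrow> (\<Sum>a<n. P i a * Q a j) = (of_bool (i = j) :: complex)"
    and QD: "\<And>i j. i < n \<Longrightarrow> j < n \<Longrightarrow> (\<Sum>a<n. Q i a * of_real (co (D (e j)) a)) = (\<Sum>a<n. J i a * Q a j)"
    and J: "\<And>i j. i < n \<Longrightarrow> j < n \<Longrightarrow> J i j \<noteq> 0 \<Longrightarrow> i < j"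
  shows "(D ^^ n) v = 0"
proof -
  have vanish: "(\<Sum>a<n. Q i a * of_real (co ((D ^^ k) v) a)) = 0" if "i < n" "n - k \<le> i" for i k
    using that
  proof (induction k arbitrary: i)
    case 0
    then show ?case by simp
  next
    case (Suc k)
    let ?u = "(D ^^ k) v"
    have "(\<Sum>a<n. Q i a * of_real (co ((D ^^ Suc k) v) a)) =
        (\<Sum>b<n. (\<Sum>a<n. Q i a * of_real (co (D (e b)) a)) * of_real (co ?u b))"
      unfolding funpow.simps o_apply co_linear_image[OF D, of ?u] of_real_sum sum_distrib_left sum_distrib_right
      by (subst sum.swap) (simp add: mult_ac)
    also have "\<dots> = (\<Sum>b<n. (\<Sum>a<n. J i a * Q a b) * of_real (co ?u b))"
      using Suc.prems(1) by (simp add: QD)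
    also have "\<dots> = (\<Sum>a<n. J i a * (\<Sum>b<n. Q a b * of_real (co ?u b)))"
      unfolding sum_distrib_left sum_distrib_right by (subst sum.swap) (simp add: mult_ac)
    also have "\<dots> = 0"
    proof (rule sum.neutral, rule ballI)
      fix a assume "a \<in> {..<n}"
      then show "J i a * (\<Sum>b<n. Q a b * of_real (co ?u b)) = 0"
        using J[of i a] Suc.IH[of a] Suc.prems by (cases "J i a = 0") auto
    qed
    finally show ?case .
  qed
  show ?thesis
  proof (rule coordinates_eqI)
    fix i assume "i < n"
    let ?u = "(D ^^ n) v"
    have "complex_of_real (co ?u i) = (\<Sum>b<n. of_bool (i = b) * of_real (co ?u b))"
      using \<open>i < n\<close> by (simp add: of_bool_def if_distrib[of "\<lambda>x. x * _"] cong: if_cong)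
    also have "\<dots> = (\<Sum>b<n. (\<Sum>a<n. P i a * Q a b) * of_real (co ?u b))"
      using \<open>i < n\<close> by (simp add: PQ)
    also have "\<dots> = (\<Sum>a<n. P i a * (\<Sum>b<n. Q a b * of_real (co ?u b)))"
      unfolding sum_distrib_left sum_distrib_right by (subst sum.swap) (simp add: mult_ac)
    also have "\<dots> = 0" by (simp add: vanish)
    finally show "co ?u i = co 0 i" by (simp add: co_simps)
  qed
qed

text \<open>
  Applied to the real part \<open>Y\<close> of the conjugated semisimple part of \<open>D\<close>, the hypothesis makes the
  trace \<open>\<Sum>i<n. |J i i|\<^sup>2\<close> of \<open>D \<circ> Y\<close> vanish, hence all eigenvalues of \<open>D\<close>.
\<close>

lemma derivation_nilpotent_if_traces_vanish:
  assumes D: "derivation D" and zero: "\<And>Y. derivation Y \<Longrightarrow> tr (\<lambda>v. D (Y v)) = 0"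
  shows "(D ^^ n) v = 0"
proof -
  let ?d = "\<lambda>i j. complex_of_real (co (D (e j)) i)"
  obtain P Q J where
    PQ: "\<And>i j. i < n \<Longrightarrow> j < n \<Longrightarrow> (\<Sum>a<n. P i a * Q a j) = of_bool (i = j)" and
    QP: "\<And>i j. i < n \<Longrightarrow> j < n \<Longrightarrow> (\<Sum>a<n. Q i a * P a j) = of_bool (i = j)" and
    DP: "\<And>i j. i < n \<Longrightarrow> j < n \<Longrightarrow> (\<Sum>a<n. ?d i a * P a j) = (\<Sum>a<n. P i a * J a j)" and
    QD: "\<And>i j. i < n \<Longrightarrow> j < n \<Longrightarrow> (\<Sum>a<n. Q i a * ?d a j) = (\<Sum>a<n. J i a * Q a j)" and
    J: "\<And>i j. i < n \<Longrightarrow> j < n \<Longrightarrow> J i j \<noteq> 0 \<Longrightarrow> i \<le> j \<and> J i i = J j j"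
    by (rule jordan_basis_exists[of n ?d]) (rule that)
  define y where "y = (\<lambda>a b. \<Sum>i<n. P a i * cnj (J i i) * Q i b)"
  define Y where "Y = (\<lambda>v. \<Sum>i<n. (\<Sum>j<n. co v j * Re (y i j)) *\<^sub>R e i)"
  have "tensor_annihilated n y y (\<lambda>j i. - y i j) (\<lambda>a b c. of_real (co (br (e a) (e b)) c))"
    unfolding y_def
    by (rule tensor_annihilated_conjugate_semisimple_part
        [OF derivation_tensor_annihilated[OF D] PQ QP DP QD J])
  note y = this
  have Y: "derivation Y"
    unfolding Y_def by (rule derivation_Re_of_annihilator(1)[OF y])
  have entry: "co (Y (e j)) i = Re (y i j)" if "i < n" "j < n" for i j
    unfolding Y_def by (rule derivation_Re_of_annihilator(2)[OF y that])
  have "linear D" using D by (simp add: derivation_def)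
  have "(\<Sum>i<n. (cmod (J i i))\<^sup>2) = Re (\<Sum>i<n. \<Sum>j<n. ?d i j * y j i)"
    unfolding y_def using trace_conjugate_semisimple_part[OF QP DP] by simp
  also have "\<dots> = tr (\<lambda>v. D (Y v))"
    unfolding tr_comp_eq[OF \<open>linear D\<close>] by (simp add: entry)
  also have "\<dots> = 0" by (rule zero[OF Y])
  finally have "\<forall>i\<in>{..<n}. (cmod (J i i))\<^sup>2 = 0" by (subst (asm) sum_nonneg_eq_0_iff) auto
  then have "J i i = 0" if "i < n" for i using that by simp
  then have strict: "i < j" if "i < n" "j < n" "J i j \<noteq> 0" for i j
    using J[OF that] that by (metis le_neq_implies_less)
  show ?thesis
    by (rule nilpotent_of_triangular[OF \<open>linear D\<close> PQ QD strict])
qed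

definition killing :: "'a \<Rightarrow> 'a \<Rightarrow> real" where
  "killing x y = tr (\<lambda>v. br x (br y v))"

lemma killing_commute: "killing x y = killing y x"
  unfolding killing_def by (rule tr_comp_commute[OF linear_br linear_br])

lemma linear_killing: "linear (killing x)"
  by (rule linearI) (simp_all add: killing_def br_simps tr_add tr_scale)

lemma bilinear_killing: "bilinear killing"
proof -
  have "(\<lambda>x. killing x y) = killing y" for y
    by (rule ext) (rule killing_commute)
  then show ?thesis
    unfolding bilinear_def by (simp add: linear_killing)
qed

lemmas killing_simps = bilinear_ladd[OF bilinear_killing] bilinear_radd[OF bilinear_killing]
  bilinear_lmul[OF bilinear_killing] bilinear_rmul[OF bilinear_killing]
  bilinear_lzero[OF bilinear_killing] bilinear_rzero[OF bilinear_killing]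
  bilinear_lsub[OF bilinear_killing] bilinear_rsub[OF bilinear_killing]
  bilinear_lneg[OF bilinear_killing] bilinear_rneg[OF bilinear_killing]

text \<open>
  By cyclicity the trace of \<open>[ad u, ad v] \<circ> D\<close> is that of \<open>ad u \<circ> [ad v, D]\<close>, and
  \<open>[ad v, D] = -ad (D v)\<close>.  The case \<open>D = ad z\<close> is the invariance of the Killing form.
\<close>

lemma trace_br_derivation:
  assumes "derivation D"
  shows "tr (\<lambda>w. br (br u v) (D w)) = - killing u (D v)"
proof -
  have lin: "linear D" and der: "D (br x y) = br (D x) y + br x (D y)" for x y
    using assms by (auto simp: derivation_def)
  have "br (br u v) (D w) = br u (br v (D w)) - br v (br u (D w))" for w
    using br_leibniz[of u v "D w"] by simp
  then have "tr (\<lambda>w. br (br u v) (D w)) = tr (\<lambda>w. br u (br v (D w))) - tr (\<lambda>w. br v (br u (D w)))"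
    by (simp add: tr_diff)
  also have "tr (\<lambda>w. br v (br u (D w))) = tr (\<lambda>w. br u (D (br v w)))"
    using linear_compose[OF lin linear_br] by (intro tr_comp_commute linear_br) (simp add: comp_def)
  also have "\<dots> = tr (\<lambda>w. br u (br (D v) w)) + tr (\<lambda>w. br u (br v (D w)))"
    by (simp add: der br_simps tr_add)
  finally show ?thesis by (simp add: killing_def)
qed

lemma killing_invariant: "killing (br x y) z = killing x (br y z)"
  using trace_br_derivation[OF derivation_br, of x y z] br_anti[of y z]
  by (simp add: killing_def[of "br x y"] killing_simps)

lemma killing_automorphism:
  assumes "lie_automorphism br f"
  shows "killing (f x) (f y) = killing x y"
proof -
  have lin: "linear f" and bij: "bij f" and hom: "f (br u v) = br (f u) (f v)" for u v
    using assms by (auto simp: lie_automorphism_def)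
  define g where "g = inv_into UNIV f"
  have fg: "f (g v) = v" and gf: "g (f v) = v" for v
    using bij unfolding g_def by (simp_all add: bij_is_surj surj_f_inv_f bij_is_inj)
  have ling: "linear (\<lambda>v. br x (br y (g v)))"
  proof -
    have "linear g"
    proof (rule linearI)
      show "g (u + v) = g u + g v" for u v
        using gf[of "g u + g v"] by (simp add: linear_add[OF lin] fg)
      show "g (c *\<^sub>R u) = c *\<^sub>R g u" for c u
        using gf[of "c *\<^sub>R g u"] by (simp add: linear_scale[OF lin] fg)
    qed
    then show ?thesis
      using linear_compose[OF linear_compose[OF _ linear_br] linear_br] by (simp add: comp_def)
  qed
  have "br (f x) (br (f y) v) = f (br x (br y (g v)))" for v by (simp add: hom fg)
  then have "killing (f x) (f y) = tr (\<lambda>v. f (br x (br y (g v))))"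
    by (simp add: killing_def)
  also have "\<dots> = tr (\<lambda>v. br x (br y (g (f v))))"
    by (rule tr_comp_commute[OF lin ling])
  finally show ?thesis by (simp add: gf killing_def)
qed

end

context lie_algebra
begin

lemma lie_ideal_span_br:
  assumes I: "lie_ideal br I"
  shows "lie_ideal br (span {br X Y | X Y. X \<in> I \<and> Y \<in> I})" (is "lie_ideal br (span ?S)")
  unfolding lie_ideal_def
proof (intro conjI allI ballI)
  show "subspace (span ?S)" by simp
  fix X Y assume "Y \<in> span ?S"
  then show "br X Y \<in> span ?S"
  proof (induction rule: span_induct)
    case base
    show ?case
      by (auto simp: subspace_def br_simps intro: span_add span_scale span_zero)
  next
    case (step y)
    then obtain a b where ab: "y = br a b" "a \<in> I" "b \<in> I" by blast
    have "br (br X a) b \<in> span ?S" "br a (br X b) \<in> span ?S"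
      using ab I by (auto simp: lie_ideal_def intro!: span_base)
    then show ?case unfolding ab(1) br_leibniz[of X a b] by (rule span_add)
  qed
qed

lemma lie_ideal_derived_series: "lie_ideal br I \<Longrightarrow> lie_ideal br (derived_series br I m)"
  by (induction m) (simp_all add: lie_ideal_span_br)

lemma derived_series_decreasing:
  assumes "lie_ideal br I"
  shows "derived_series br I (Suc m) \<subseteq> derived_series br I m"
  using lie_ideal_derived_series[OF assms, of m]
  unfolding derived_series.simps by (intro span_minimal) (auto simp: lie_ideal_def)

lemma lie_ideal_lie_center:
  assumes P: "lie_ideal br P"
  shows "lie_ideal br (lie_center br P)"
  unfolding lie_ideal_def
proof (intro conjI allI ballI)
  show "subspace (lie_center br P)"
    using P by (auto simp: lie_ideal_def lie_center_def subspace_def br_simps)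
  fix X Z assume Z: "Z \<in> lie_center br P"
  have "br (br X Z) Y = 0" if "Y \<in> P" for Y
  proof -
    have "br X (br Z Y) = br (br X Z) Y + br Z (br X Y)" by (rule br_leibniz)
    moreover have "br Z Y = 0" "br Z (br X Y) = 0"
      using Z that P by (auto simp: lie_center_def lie_ideal_def)
    ultimately show ?thesis by (simp add: br_simps)
  qed
  then show "br X Z \<in> lie_center br P"
    using Z P by (auto simp: lie_center_def lie_ideal_def)
qed

lemma semisimple_lie_center_ideal:
  assumes "lie_semisimple br" "lie_ideal br P"
  shows "lie_center br P = {0}"
proof -
  let ?C = "lie_center br P"
  have "0 \<in> ?C" using lie_ideal_lie_center[OF assms(2)] by (simp add: lie_ideal_def subspace_0)
  then have "{br X Y | X Y. X \<in> ?C \<and> Y \<in> ?C} = {0}"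
    by (auto simp: lie_center_def br_simps intro!: exI[of _ 0])
  then have "derived_series br ?C (Suc 0) = {0}" by simp
  then have "lie_solvable br ?C" unfolding lie_solvable_def by blast
  then show ?thesis
    using assms lie_ideal_lie_center by (auto simp: lie_semisimple_def)
qed

end

lemma (in fin_dim_lie_algebra) derived_series_stabilizes:
  assumes "lie_ideal br I"
  obtains m where "derived_series br I (Suc m) = derived_series br I m"
proof -
  obtain m where m: "\<And>k. dim (derived_series br I m) \<le> dim (derived_series br I k)"
    using ex_has_least_nat[of "\<lambda>_. True" 0 "\<lambda>m. dim (derived_series br I m)"] by auto
  have "derived_series br I (Suc m) = derived_series br I m"
    using lie_ideal_derived_series[OF assms] m derived_series_decreasing[OF assms]
    by (intro subspace_eqI_dim) (auto simp: lie_ideal_def simp del: derived_series.simps)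
  then show thesis by (rule that)
qed

context lie_algebra_coordinates
begin

text \<open>
  Cartan's criterion.  If the radical \<open>K\<close> of the Killing form were not solvable, the stable term
  \<open>P\<close> of its derived series would be a nonzero ideal with \<open>P = [P, P]\<close> whose elements are all
  ad-nilpotent; Engel's theorem then gives \<open>P\<close> a nonzero centre.
\<close>

theorem killing_nondegenerate:
  assumes ss: "lie_semisimple br" and x: "\<And>y. killing x y = 0"
  shows "x = 0"
proof -
  define K where "K = {x. \<forall>y. killing x y = 0}"
  have K: "lie_ideal br K"
  proof -
    have "killing (br X Y) y = 0" if "\<And>y. killing Y y = 0" for X Y y
      using that[of "br X y"] killing_invariant[of Y X y]
      by (simp add: br_anti[of X Y] killing_simps)
    then show ?thesis
      unfolding lie_ideal_def K_def by (simp add: subspace_def killing_simps)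
  qed
  obtain m where m: "derived_series br K (Suc m) = derived_series br K m"
    using derived_series_stabilizes[OF K] .
  define P where "P = derived_series br K m"
  have P: "lie_ideal br P" unfolding P_def by (rule lie_ideal_derived_series[OF K])
  have Psub: "subspace P" and Pbr: "\<And>x y. y \<in> P \<Longrightarrow> br x y \<in> P"
    using P by (auto simp: lie_ideal_def)
  have Pspan: "P = span {br u v | u v. u \<in> P \<and> v \<in> P}"
    using m by (simp add: P_def)
  have "derived_series br K j \<subseteq> K" for j
    by (induction j) (use derived_series_decreasing[OF K] in force)+
  then have PK: "P \<subseteq> K" by (simp add: P_def)
  have trace: "tr (\<lambda>w. br z (Y w)) = 0" if Y: "derivation Y" and z: "z \<in> P" for Y z
  proof -
    have "z \<in> span {br u v | u v. u \<in> P \<and> v \<in> P}" using z Pspan by blast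
    then show ?thesis
    proof (induction rule: span_induct)
      case base
      show ?case by (auto simp: subspace_def br_simps tr_add tr_scale tr_zero)
    next
      case (step z)
      then obtain u v where "z = br u v" "u \<in> K" using PK by blast
      then show ?case by (simp add: trace_br_derivation[OF Y] K_def)
    qed
  qed
  have nilp: "\<exists>m. (br z ^^ m) w = 0" if "z \<in> P" for z w
    using derivation_nilpotent_if_traces_vanish[OF derivation_br trace[OF _ that]] by blast
  have "P = {0}"
  proof (rule ccontr)
    assume "P \<noteq> {0}"
    then have "\<exists>w\<in>P - {0}. \<forall>z\<in>P. br z w \<in> {0}"
      by (intro engel) (use Psub Pbr nilp subspace_0[OF Psub] in \<open>auto simp: br_simps\<close>)
    then obtain w where "w \<in> P" "w \<noteq> 0" "\<And>z. z \<in> P \<Longrightarrow> br z w = 0" by auto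
    then have "w \<in> lie_center br P" using br_anti[of w] by (simp add: lie_center_def)
    then show False using semisimple_lie_center_ideal[OF ss P] \<open>w \<noteq> 0\<close> by blast
  qed
  then have "lie_solvable br K" unfolding lie_solvable_def P_def by blast
  then have "K = {0}" using K ss by (simp add: lie_semisimple_def)
  moreover have "x \<in> K" using x by (simp add: K_def)
  ultimately show ?thesis by simp
qed

lemma killing_represents:
  assumes ss: "lie_semisimple br" and "linear \<phi>"
  obtains z where "\<And>x. killing z x = \<phi> x"
proof -
  define \<Psi> where "\<Psi> z = (\<Sum>i<n. killing z (e i) *\<^sub>R e i)" for z
  have lin: "linear \<Psi>"
    by (rule linearI) (simp_all add: \<Psi>_def killing_simps scaleR_add_left sum.distrib scaleR_right.sum)
  have ext: "killing z x = \<phi>' x" if "linear \<phi>'" "\<And>i. i < n \<Longrightarrow> killing z (e i) = \<phi>' (e i)" for z x \<phi>'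
  proof -
    have "killing z x = (\<Sum>i<n. co x i * killing z (e i))"
      by (subst expand[symmetric, of x]) (simp add: linear_sum[OF linear_killing] killing_simps)
    also have "\<dots> = \<phi>' (\<Sum>i<n. co x i *\<^sub>R e i)"
      using that by (simp add: linear_sum linear_scale)
    finally show ?thesis by (simp add: expand)
  qed
  have "z = 0" if "\<Psi> z = 0" for z
  proof (rule killing_nondegenerate[OF ss])
    fix y
    have "killing z (e i) = 0" if "i < n" for i
    proof -
      have "killing z (e i) = co (\<Psi> z) i" by (simp only: \<Psi>_def co_sum[OF that])
      then show ?thesis by (simp add: \<open>\<Psi> z = 0\<close> co_simps)
    qed
    then show "killing z y = 0" using ext[of "\<lambda>_. 0" z y] by (simp add: linear_zero)
  qed
  then have "surj \<Psi>" using injective_endomorphism_surj[OF lin] by blast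
  then obtain z where z: "\<Psi> z = (\<Sum>i<n. \<phi> (e i) *\<^sub>R e i)" by (metis surjD)
  have "killing z (e i) = \<phi> (e i)" if "i < n" for i
    using arg_cong[OF z, of "\<lambda>v. co v i"] that by (simp add: \<Psi>_def co_sum)
  then show thesis using that ext[OF assms(2)] by blast
qed

text \<open>
  Choose \<open>Z\<close> so that \<open>E = D - ad Z\<close> has zero trace against every \<open>ad x\<close>; for \<open>x = [u, v]\<close> that trace
  is \<open>-B(u, E v)\<close>, so \<open>E = 0\<close>.
\<close>

theorem derivation_inner:
  assumes ss: "lie_semisimple br" and D: "derivation D"
  obtains Z where "\<And>x. D x = br Z x"
proof -
  have "linear (\<lambda>x. tr (\<lambda>w. br x (D w)))"
    by (rule linearI) (simp_all add: br_simps tr_add tr_scale)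
  then obtain Z where Z: "\<And>x. killing Z x = tr (\<lambda>w. br x (D w))"
    using killing_represents[OF ss] by blast
  define E where "E x = D x - br Z x" for x
  have E: "derivation E"
    unfolding derivation_def
  proof (intro conjI allI)
    show "linear E"
      using D linear_compose_sub[OF _ linear_br, of D Z] by (simp add: derivation_def E_def[abs_def])
    show "E (br x y) = br (E x) y + br x (E y)" for x y
      using D by (simp add: derivation_def E_def br_simps br_leibniz[of Z x y])
  qed
  have "E x = 0" for x
  proof (rule killing_nondegenerate[OF ss])
    fix u
    have "tr (\<lambda>w. br (br u x) (E w)) = tr (\<lambda>w. br (br u x) (D w)) - killing (br u x) Z"
      by (simp add: E_def br_simps tr_diff killing_def)
    also have "\<dots> = 0" using Z[of "br u x"] killing_commute[of Z] by simp
    finally show "killing (E x) u = 0"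
      using trace_br_derivation[OF E, of u x] killing_commute[of u] by simp
  qed
  then show thesis using that by (simp add: E_def)
qed

text \<open>
  The second cohomology of a semisimple Lie algebra vanishes: writing \<open>\<omega>(X, Y) = B(D X, Y)\<close>, the
  cocycle identity says that \<open>D\<close> is a derivation, and \<open>D = ad Z\<close>.
\<close>

theorem cocycle_eq_killing_br:
  assumes ss: "lie_semisimple br" and cocycle: "ce_2cocycle br \<omega>"
  obtains Z where "\<And>X Y. \<omega> X Y = killing Z (br X Y)"
proof -
  have bil: "bilinear \<omega>" and skew: "\<omega> X Y = - \<omega> Y X"
    and closed: "- \<omega> (br X Y) Z + \<omega> (br X Z) Y - \<omega> (br Y Z) X = 0" for X Y Z
    using cocycle unfolding ce_2cocycle_def skew_on_def ce_d2_def by blast+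
  have "\<exists>D. \<forall>Y. killing D Y = \<omega> X Y" for X
    using killing_represents[OF ss, of "\<omega> X"] bil unfolding bilinear_def by metis
  then obtain D where D: "\<And>X Y. killing (D X) Y = \<omega> X Y" by metis
  have eqI: "u = v" if "\<And>Y. killing u Y = killing v Y" for u v
    using killing_nondegenerate[OF ss, of "u - v"] that by (simp add: killing_simps)
  have "derivation D"
    unfolding derivation_def
  proof (intro conjI allI linearI)
    show "D (X + Y) = D X + D Y" for X Y
      by (rule eqI) (simp add: killing_simps D bilinear_ladd[OF bil])
    show "D (c *\<^sub>R X) = c *\<^sub>R D X" for c X
      by (rule eqI) (simp add: killing_simps D bilinear_lmul[OF bil])
    show "D (br X Y) = br (D X) Y + br X (D Y)" for X Y
    proof (rule eqI)
      fix Z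
      have "killing (br (D X) Y + br X (D Y)) Z = \<omega> X (br Y Z) - \<omega> Y (br X Z)"
        unfolding br_anti[of X "D Y"] by (simp add: killing_simps killing_invariant D)
      then show "killing (D (br X Y)) Z = killing (br (D X) Y + br X (D Y)) Z"
        unfolding D using closed[of X Y Z] skew[of X "br Y Z"] skew[of Y "br X Z"] by simp
    qed
  qed
  then obtain Z where "\<And>x. D x = br Z x" using derivation_inner[OF ss] by blast
  then have "\<omega> X Y = killing Z (br X Y)" for X Y
    using D[of X Y] by (simp add: killing_invariant)
  then show thesis by (rule that)
qed

end

section \<open>Symplectic k-symmetric pairs\<close>

locale k_symmetric = lie_algebra_coordinates br n e co
  for br :: "'a::real_vector \<Rightarrow> 'a \<Rightarrow> 'a" and n e co +
  fixes \<nu> :: "'a \<Rightarrow> 'a" and k :: nat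
  assumes pair: "k_symmetric_pair br \<nu> k"
begin

abbreviation \<hh> :: "'a set" where "\<hh> \<equiv> canon_h \<nu>"
abbreviation \<mm> :: "'a set" where "\<mm> \<equiv> canon_m \<nu>"

lemma automorphism: "lie_automorphism br \<nu>"
  using pair by (simp add: k_symmetric_pair_def)

lemma linear_nu: "linear \<nu>" and nu_br: "\<nu> (br X Y) = br (\<nu> X) (\<nu> Y)"
  using automorphism by (auto simp: lie_automorphism_def)

lemma canon_h_iff: "X \<in> \<hh> \<longleftrightarrow> \<nu> X = X"
  by (auto simp: canon_h_def)

lemma subspace_h: "subspace \<hh>"
  by (auto simp: subspace_def canon_h_iff linear_0[OF linear_nu] linear_add[OF linear_nu]
      linear_scale[OF linear_nu])

lemma subspace_m: "subspace \<mm>"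
  unfolding canon_m_def
  using linear_subspace_image[OF linear_compose_sub[OF linear_ident linear_nu] subspace_UNIV] .

lemma nu_m: "X \<in> \<mm> \<Longrightarrow> \<nu> X \<in> \<mm>"
  by (auto simp: canon_m_def linear_diff[OF linear_nu])

lemma br_h_m:
  assumes "H \<in> \<hh>" "X \<in> \<mm>"
  shows "br H X \<in> \<mm>"
proof -
  obtain Y where "X = Y - \<nu> Y" using assms(2) by (auto simp: canon_m_def)
  then have "br H X = br H Y - \<nu> (br H Y)"
    using assms(1) by (simp add: br_simps nu_br canon_h_iff)
  then show ?thesis by (auto simp: canon_m_def)
qed

lemma proj_m_in: "proj_m \<nu> X \<in> \<mm>" and proj_m_compl: "X - proj_m \<nu> X \<in> \<hh>"
  using theI'[OF canon_decomp[OF pair, of X]] by (auto simp: proj_m_def)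

lemma proj_m_eqI: "M \<in> \<mm> \<Longrightarrow> X - M \<in> \<hh> \<Longrightarrow> proj_m \<nu> X = M"
  using canon_decomp[OF pair, of X] proj_m_in proj_m_compl by blast

lemma proj_m_of_m: "X \<in> \<mm> \<Longrightarrow> proj_m \<nu> X = X"
  by (rule proj_m_eqI) (simp_all add: subspace_0[OF subspace_h])

lemma proj_m_of_h: "X \<in> \<hh> \<Longrightarrow> proj_m \<nu> X = 0"
  by (rule proj_m_eqI) (simp_all add: subspace_0[OF subspace_m])

lemma proj_m_nu: "proj_m \<nu> (\<nu> X) = \<nu> (proj_m \<nu> X)"
proof (rule proj_m_eqI[OF nu_m[OF proj_m_in]])
  show "\<nu> X - \<nu> (proj_m \<nu> X) \<in> \<hh>"
    using proj_m_compl[of X] by (simp add: canon_h_iff linear_diff[OF linear_nu])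
qed

lemma killing_nu: "killing (\<nu> X) (\<nu> Y) = killing X Y"
  by (rule killing_automorphism[OF automorphism])

text \<open>
  As \<open>\<nu>\<close> fixes \<open>H\<close> and preserves the Killing form, \<open>H\<close> pairs equally with \<open>Y\<close> and \<open>\<nu> Y\<close>.
\<close>

lemma killing_h_m:
  assumes "H \<in> \<hh>" "X \<in> \<mm>"
  shows "killing H X = 0"
proof -
  obtain Y where "X = Y - \<nu> Y" using assms(2) by (auto simp: canon_m_def)
  then show ?thesis using killing_nu[of H Y] assms(1) by (simp add: killing_simps canon_h_iff)
qed

lemma central_killing_h_left:
  assumes "Z \<in> lie_center br \<hh>" "H \<in> \<hh>"
  shows "killing Z (br H X) = 0" "killing Z (br X H) = 0"
proof -
  show 1: "killing Z (br H X) = 0" for X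
    using assms killing_invariant[of Z H X] by (simp add: lie_center_def killing_simps)
  show "killing Z (br X H) = 0"
    using 1[of X] by (simp add: br_anti[of X H] killing_simps)
qed

text \<open>
  The form is \<open>\<Omega>(X, Y) = B(Z, [X, Y]) = B([Z, X], Y)\<close>.  It is the coboundary of a linear form on the
  whole algebra, and its extension by zero from \<open>\<mm>\<close> is that coboundary because \<open>Z\<close> centralizes \<open>\<hh>\<close>.
\<close>

lemma symplectic_if_central_element:
  assumes ss: "lie_semisimple br" and Z: "Z \<in> lie_center br \<hh>"
    and ker: "{X \<in> \<mm>. br Z X = 0} = {0}"
  shows "symplectic_pair br \<nu>"
proof -
  define \<Omega> where "\<Omega> X Y = killing Z (br X Y)" for X Y
  note Z0 = central_killing_h_left[OF Z]
  have Zh: "Z \<in> \<hh>" using Z by (simp add: lie_center_def)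
  have ext: "extend_form \<nu> \<Omega> = \<Omega>"
  proof (intro ext)
    fix X Y
    let ?M = "proj_m \<nu> X" and ?N = "proj_m \<nu> Y"
    have "br X Y = br (X - ?M) Y + br ?M (Y - ?N) + br ?M ?N" by (simp add: br_simps)
    then show "extend_form \<nu> \<Omega> X Y = \<Omega> X Y"
      by (simp add: extend_form_def \<Omega>_def killing_simps Z0 proj_m_compl)
  qed
  have nondeg: "X = 0" if X: "X \<in> \<mm>" and 0: "\<And>Y. Y \<in> \<mm> \<Longrightarrow> \<Omega> X Y = 0" for X
  proof -
    have "br Z X = 0"
    proof (rule killing_nondegenerate[OF ss])
      fix Y
      let ?N = "proj_m \<nu> Y"
      have "killing (br Z X) ?N = 0"
        using 0[OF proj_m_in] by (simp add: \<Omega>_def killing_invariant)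
      moreover have "killing (br Z X) (Y - ?N) = 0"
        using killing_h_m[OF proj_m_compl br_h_m[OF Zh X]] killing_commute by simp
      ultimately show "killing (br Z X) Y = 0" by (simp add: killing_simps)
    qed
    then show ?thesis using X ker by blast
  qed
  have "bilinear \<Omega>"
    unfolding bilinear_def \<Omega>_def
    by (auto intro!: linearI simp: br_simps killing_simps)
  moreover have "\<Omega> X Y = - \<Omega> Y X" for X Y
    by (simp add: \<Omega>_def br_anti[of X Y] killing_simps)
  moreover have "ce_d2 br \<Omega> X Y W = 0" for X Y W
  proof -
    have "- br (br X Y) W + br (br X W) Y - br (br Y W) X = 0"
      using br_leibniz[of X Y W] by (simp add: br_anti[of "br X W" Y] br_anti[of "br Y W" X])
    then have "killing Z (- br (br X Y) W + br (br X W) Y - br (br Y W) X) = 0"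
      by (simp add: killing_simps)
    then show ?thesis by (simp add: ce_d2_def \<Omega>_def killing_simps)
  qed
  ultimately have cocycle: "ce_2cocycle br (extend_form \<nu> \<Omega>)"
    unfolding ext ce_2cocycle_def skew_on_def by blast
  show ?thesis
    unfolding symplectic_pair_def
  proof (intro exI[of _ \<Omega>] conjI ballI cocycle)
    show "bilinear_form_on \<mm> \<Omega>"
      by (simp add: bilinear_form_on_def \<Omega>_def br_simps killing_simps)
    show "skew_on \<mm> \<Omega>"
      using cocycle unfolding ext ce_2cocycle_def skew_on_def by blast
    show "nondegenerate_on \<mm> \<Omega>"
      using nondeg by (auto simp: nondegenerate_on_def)
    show "\<Omega> (br H X) Y + \<Omega> X (br H Y) = 0" if "H \<in> \<hh>" for H X Y
      using Z0(1)[OF that, of "br X Y"] by (simp add: \<Omega>_def br_leibniz[of H X Y] killing_simps)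
    show "\<Omega> (\<nu> X) (\<nu> Y) = \<Omega> X Y" for X Y
      using killing_nu[of Z "br X Y"] Zh by (simp add: \<Omega>_def nu_br canon_h_iff)
  qed
qed

text \<open>
  Each property of the form becomes one of the element \<open>Z\<close> that represents its extension:
  vanishing on \<open>\<hh>\<close> gives \<open>[Z, \<hh>] = 0\<close>, invariance under \<open>\<nu>\<close> gives \<open>\<nu> Z = Z\<close> because the adjoint
  representation is faithful, and nondegeneracy gives injectivity of \<open>ad Z\<close> on \<open>\<mm>\<close>.
\<close>

lemma central_element_if_symplectic:
  assumes ss: "lie_semisimple br" and sympl: "symplectic_pair br \<nu>"
  obtains Z where "Z \<in> lie_center br \<hh>" "{X \<in> \<mm>. br Z X = 0} = {0}"
proof -
  obtain \<Omega> where nondeg: "nondegenerate_on \<mm> \<Omega>"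
    and inv: "\<And>X Y. X \<in> \<mm> \<Longrightarrow> Y \<in> \<mm> \<Longrightarrow> \<Omega> (\<nu> X) (\<nu> Y) = \<Omega> X Y"
    and cocycle: "ce_2cocycle br (extend_form \<nu> \<Omega>)"
    using sympl unfolding symplectic_pair_def by blast
  define \<omega> where "\<omega> = extend_form \<nu> \<Omega>"
  obtain Z where Z: "\<And>X Y. \<omega> X Y = killing Z (br X Y)"
    using cocycle_eq_killing_br[OF ss cocycle] unfolding \<omega>_def by blast
  have ad_zero: "br W X = 0" if "\<And>Y. killing W (br X Y) = 0" for W X
    using killing_nondegenerate[OF ss, of "br W X"] that by (simp add: killing_invariant)
  have bil: "bilinear \<omega>" using cocycle by (simp add: ce_2cocycle_def \<omega>_def)
  have "\<omega> H Y = 0" if "H \<in> \<hh>" for H Y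
  proof -
    have "\<omega> H Y = \<omega> 0 Y"
      using that by (simp add: \<omega>_def extend_form_def proj_m_of_h subspace_0[OF subspace_h])
    then show ?thesis by (simp add: bilinear_lzero[OF bil])
  qed
  then have centralizes: "br Z H = 0" if "H \<in> \<hh>" for H
    using that Z by (intro ad_zero) metis
  have "\<omega> (\<nu> X) (\<nu> Y) = \<omega> X Y" for X Y
    by (simp add: \<omega>_def extend_form_def proj_m_nu inv proj_m_in)
  then have "killing (\<nu> Z - Z) (\<nu> (br X Y)) = 0" for X Y
    using killing_nu[of Z "br X Y"] by (simp add: Z nu_br killing_simps)
  moreover have "surj \<nu>" using automorphism by (simp add: lie_automorphism_def bij_is_surj)
  ultimately have "killing (\<nu> Z - Z) (br X Y) = 0" for X Y
    by (metis nu_br surjD)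
  then have "br (\<nu> Z - Z) X = 0" for X by (intro ad_zero)
  then have "\<nu> Z - Z = 0"
    by (intro killing_nondegenerate[OF ss]) (simp add: killing_def br_simps tr_zero)
  then have "Z \<in> lie_center br \<hh>"
    using centralizes by (simp add: lie_center_def canon_h_iff)
  moreover have "X = 0" if "X \<in> \<mm>" "br Z X = 0" for X
  proof -
    have "\<Omega> X Y = 0" if "Y \<in> \<mm>" for Y
      using Z[of X Y] killing_invariant[of Z X Y] \<open>X \<in> \<mm>\<close> that \<open>br Z X = 0\<close>
      by (simp add: \<omega>_def extend_form_def proj_m_of_m killing_simps)
    then show ?thesis using nondeg that(1) by (simp add: nondegenerate_on_def)
  qed
  then have "{X \<in> \<mm>. br Z X = 0} = {0}"
    using subspace_0[OF subspace_m] by (auto simp: br_simps)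
  ultimately show thesis by (rule that)
qed

end

theorem theorem4:
  fixes br :: "'a::real_vector \<Rightarrow> 'a \<Rightarrow> 'a" and \<nu> :: "'a \<Rightarrow> 'a" and k :: nat
  assumes "k \<ge> 2"
    and "k_symmetric_pair br \<nu> k"
    and "lie_semisimple br"
  shows "symplectic_pair br \<nu> \<longleftrightarrow>
    (\<exists>Z \<in> lie_center br (canon_h \<nu>). {X \<in> canon_m \<nu>. br Z X = 0} = {0})"
proof -
  interpret fin_dim_lie_algebra br
    using assms(2) by (simp add: k_symmetric_pair_def)
  obtain n co and e :: "nat \<Rightarrow> 'a" where "coordinates n e co"
    using coordinates_exist by blast
  then interpret coordinates n e co .
  interpret k_symmetric br n e co \<nu> k
    by unfold_locales (rule assms(2))
  show ?thesis
    using symplectic_if_central_element[OF assms(3)] central_element_if_symplectic[OF assms(3)]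
    by metis
qed

end
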